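(* Let $R$ be a commutative Noetherian domain with field of fractions $Q$, $C$ a finite abelian group, $\mathbf{T}$ a commutative $C$-graded $R$-algebra with an involution $\iota$, $W$ a group with a homomorphism $\nu\colon W\to C$, and let $\mathbf{A}$ be a $C$-graded $R$-algebra, finitely generated as an $R$-module, with a grading-preserving surjection of $R$-algebras $\mathbf{T}[W]\to\mathbf{A}$. Assume that the image of $\mathbf{T}$ in $\mathbf{A}$ is reduced, and that $\iota$, extended to $\mathbf{T}[W]$ by $\iota(w)=w^{-1}$ for $w\in W$, descends to $\mathbf{A}$. Let $M$ be a graded $\mathbf{A}$-module that is $R$-torsion-free, and let $L$ be a field containing $Q$. Then $M$ is polarisable over $Q$ if and only if $M$ is polarisable over $L$.
   Context: An $R$-algebra is a ring with a ring homomorphism from $R$ to its centre. A $C$-grading on an $R$-algebra $\mathbf{B}$ is a decomposition $\mathbf{B}=\bigoplus_{c\in C}\mathbf{B}_c$ into $R$-submodules with $\mathbf{B}_c\mathbf{B}_{c'}\subset\mathbf{B}_{cc'}$. $\mathbf{T}[W]$ is $C$-graded by giving $t\cdot w$, $t\in\mathbf{T}_{c'}$, $w\in W$, degree $c'\nu(w)$. A graded $\mathbf{A}$-module is a finitely generated $\mathbf{A}$-module $M$ with a decomposition $M=\bigoplus_{c\in C}M_c$ such that $\mathbf{A}_cM_{c'}\subset M_{cc'}$. An involution on $\mathbf{T}$ is an $R$-module homomorphism $\iota\colon\mathbf{T}\to\mathbf{T}$ with $\iota^2=\mathrm{id}$, $\iota(xy)=\iota(y)\iota(x)$ for all $x,y$,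 and $\iota(\mathbf{T}_c)=\mathbf{T}_{c^{-1}}$ for all $c\in C$; its extension to $\mathbf{T}[W]$ and to $\mathbf{A}$ is again an anti-multiplicative involution, also denoted by $\iota$. For a field $L\supset Q$, a polarisation on $M$ over $L$ is a non-degenerate $R$-bilinear pairing $M\otimes_RM\to L$ (that is, its $L$-bilinear extension to $L\otimes_RM$ is non-degenerate) such that for $c\ne c'\in C$ the submodules $M_c$ and $M_{c'}$ are orthogonal, and such that every $T\in\mathbf{A}$ is adjoint to $\iota(T)$. $M$ is polarisable over $L$ if it admits a polarisation over $L$. *)

theory Defs
  imports Complex_Main "HOL-Library.Poly_Mapping" "HOL-Computational_Algebra.Fraction_Field"
begin

text \<open>
  Groups are written additively: the grading group has a type of sort \<open>{finite, ab_group_add}\<close>,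
  the (not necessarily commutative) group \<open>W\<close> one of class \<open>group_add\<close>, whose unit is \<open>0\<close> and
  whose inversion is unary minus. Unital rings that are allowed to be zero have the sort
  \<open>{ring, monoid_mult}\<close>, which is \<open>ring_1\<close> without \<open>0 \<noteq> 1\<close>.
\<close>

definition noetherian :: "'r::comm_ring_1 itself \<Rightarrow> bool"
  where "noetherian _ \<longleftrightarrow>
    (\<forall>I :: 'r set. module.subspace (*) I \<longrightarrow> (\<exists>F. finite F \<and> I = module.span (*) F))"

definition unital_ring_hom :: "('b::{ring,monoid_mult} \<Rightarrow> 'd::{ring,monoid_mult}) \<Rightarrow> bool"
  where "unital_ring_hom h \<longleftrightarrow>
    h 1 = 1 \<and> (\<forall>x y. h (x + y) = h x + h y) \<and> (\<forall>x y. h (x * y) = h x * h y)"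

text \<open>An algebra is given by its structure map \<open>\<phi>\<close> from the base ring to the centre.\<close>

definition algebra_map :: "('r::comm_ring_1 \<Rightarrow> 'b::{ring,monoid_mult}) \<Rightarrow> bool"
  where "algebra_map \<phi> \<longleftrightarrow> unital_ring_hom \<phi> \<and> (\<forall>r b. \<phi> r * b = b * \<phi> r)"

definition algebra_scale :: "('r \<Rightarrow> 'b) \<Rightarrow> 'r \<Rightarrow> 'b::times \<Rightarrow> 'b"
  where "algebra_scale \<phi> r b = \<phi> r * b"

definition direct_sum_decomposition :: "('c::finite \<Rightarrow> 'b::comm_monoid_add set) \<Rightarrow> bool"
  where "direct_sum_decomposition B \<longleftrightarrow>
    (\<forall>x. \<exists>!f. (\<forall>c. f c \<in> B c) \<and> x = (\<Sum>c\<in>UNIV. f c))"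

definition algebra_grading ::
    "('r::comm_ring_1 \<Rightarrow> 'b::{ring,monoid_mult}) \<Rightarrow> ('c::{finite,ab_group_add} \<Rightarrow> 'b set) \<Rightarrow> bool"
  where "algebra_grading \<phi> B \<longleftrightarrow>
    (\<forall>c. module.subspace (algebra_scale \<phi>) (B c)) \<and> direct_sum_decomposition B \<and>
    (\<forall>c c'. \<forall>x\<in>B c. \<forall>y\<in>B c'. x * y \<in> B (c + c'))"

definition graded_involution ::
    "('r::comm_ring_1 \<Rightarrow> 'b::{ring,monoid_mult}) \<Rightarrow> ('c::{finite,ab_group_add} \<Rightarrow> 'b set) \<Rightarrow>
     ('b \<Rightarrow> 'b) \<Rightarrow> bool"
  where "graded_involution \<phi> B \<iota> \<longleftrightarrow>
    module_hom (algebra_scale \<phi>) (algebra_scale \<phi>) \<iota> \<and> (\<forall>x. \<iota> (\<iota> x) = x) \<and>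
    (\<forall>x y. \<iota> (x * y) = \<iota> y * \<iota> x) \<and> (\<forall>c. \<iota> ` B c = B (- c))"

definition reduced_on :: "'b::{ring,monoid_mult} set \<Rightarrow> bool"
  where "reduced_on S \<longleftrightarrow> (\<forall>x\<in>S. \<forall>n. x ^ n = 0 \<longrightarrow> x = 0)"


text \<open>
  The group ring \<open>T[W]\<close> is the type \<open>'w \<Rightarrow>\<^sub>0 't\<close> with its convolution product; the element
  \<open>t \<cdot> w\<close> is \<open>Poly_Mapping.single w t\<close>.
\<close>

definition group_ring_component ::
    "('c::{finite,ab_group_add} \<Rightarrow> 't::zero set) \<Rightarrow> ('w \<Rightarrow> 'c) \<Rightarrow> 'c \<Rightarrow> ('w \<Rightarrow>\<^sub>0 't) set"
  where "group_ring_component T \<nu> d =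
    {f. \<forall>w. \<exists>c'. Poly_Mapping.lookup f w \<in> T c' \<and> c' + \<nu> w = d}"

definition group_ring_involution ::
    "('t::comm_monoid_add \<Rightarrow> 't) \<Rightarrow> ('w::group_add \<Rightarrow>\<^sub>0 't) \<Rightarrow> ('w \<Rightarrow>\<^sub>0 't)"
  where "group_ring_involution \<iota> f =
    (\<Sum>w\<in>Poly_Mapping.keys f. Poly_Mapping.single (- w) (\<iota> (Poly_Mapping.lookup f w)))"

text \<open>
  The unit of \<open>T[W]\<close> is spelled out because the library's \<open>1 :: 'w \<Rightarrow>\<^sub>0 't\<close> needs \<open>0 \<noteq> 1\<close> in \<open>'t\<close>.
\<close>

definition group_ring_algebra_hom ::
    "('r \<Rightarrow> 't::{comm_ring,comm_monoid_mult}) \<Rightarrow> ('r \<Rightarrow> 'a::{ring,monoid_mult}) \<Rightarrow>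
     (('w::group_add \<Rightarrow>\<^sub>0 't) \<Rightarrow> 'a) \<Rightarrow> bool"
  where "group_ring_algebra_hom \<phi>T \<phi>A p \<longleftrightarrow>
    p (Poly_Mapping.single 0 1) = 1 \<and>
    (\<forall>f g. p (f + g) = p f + p g) \<and> (\<forall>f g. p (f * g) = p f * p g) \<and>
    (\<forall>r. p (Poly_Mapping.single 0 (\<phi>T r)) = \<phi>A r)"


definition left_module :: "('a::{ring,monoid_mult} \<Rightarrow> 'm::ab_group_add \<Rightarrow> 'm) \<Rightarrow> bool"
  where "left_module act \<longleftrightarrow>
    (\<forall>a x y. act a (x + y) = act a x + act a y) \<and> (\<forall>a b x. act (a + b) x = act a x + act b x) \<and>
    (\<forall>a b x. act (a * b) x = act a (act b x)) \<and> (\<forall>x. act 1 x = x)"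

definition finitely_generated_module :: "('s \<Rightarrow> 'm::ab_group_add \<Rightarrow> 'm) \<Rightarrow> bool"
  where "finitely_generated_module act \<longleftrightarrow>
    (\<exists>F. finite F \<and> (\<forall>x. \<exists>a. x = (\<Sum>y\<in>F. act (a y) y)))"

text \<open>The \<open>R\<close>-module structure of a module over the \<open>R\<close>-algebra \<open>A\<close>.\<close>

definition restrict_scale :: "('r \<Rightarrow> 'a) \<Rightarrow> ('a \<Rightarrow> 'm \<Rightarrow> 'm) \<Rightarrow> 'r \<Rightarrow> 'm \<Rightarrow> 'm"
  where "restrict_scale \<phi> act r x = act (\<phi> r) x"

definition graded_module ::
    "('r::comm_ring_1 \<Rightarrow> 'a::{ring,monoid_mult}) \<Rightarrow> ('c::{finite,ab_group_add} \<Rightarrow> 'a set) \<Rightarrow>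
     ('a \<Rightarrow> 'm::ab_group_add \<Rightarrow> 'm) \<Rightarrow> ('c \<Rightarrow> 'm set) \<Rightarrow> bool"
  where "graded_module \<phi> A act M \<longleftrightarrow>
    left_module act \<and> finitely_generated_module act \<and>
    (\<forall>c. module.subspace (restrict_scale \<phi> act) (M c)) \<and> direct_sum_decomposition M \<and>
    (\<forall>c c'. \<forall>a\<in>A c. \<forall>x\<in>M c'. act a x \<in> M (c + c'))"

definition torsion_free :: "('r::zero \<Rightarrow> 'm::zero \<Rightarrow> 'm) \<Rightarrow> bool"
  where "torsion_free s \<longleftrightarrow> (\<forall>r x. s r x = 0 \<longrightarrow> r = 0 \<or> x = 0)"


text \<open>
  For a ring homomorphism \<open>e\<close> from \<open>R\<close> to a field \<open>L\<close>, the base change \<open>L \<otimes>\<^sub>R M\<close> is the quotient of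
  the free \<open>L\<close>-vector space \<open>'m \<Rightarrow>\<^sub>0 'l\<close> on the underlying set of \<open>M\<close> by the \<open>L\<close>-span of the
  relations \<open>[x + y] = [x] + [y]\<close> and \<open>[r x] = e r [x]\<close>; the class of \<open>Poly_Mapping.single x l\<close>
  is \<open>l \<otimes> x\<close>. Elements of \<open>L \<otimes>\<^sub>R M\<close> are handled through representatives in \<open>'m \<Rightarrow>\<^sub>0 'l\<close>, and
  \<open>tensor_null\<close> is the set of representatives of \<open>0\<close>.
\<close>

definition tensor_relations ::
    "('r \<Rightarrow> 'l::field) \<Rightarrow> ('r \<Rightarrow> 'm::ab_group_add \<Rightarrow> 'm) \<Rightarrow> ('m \<Rightarrow>\<^sub>0 'l) set"
  where "tensor_relations e s =
    {Poly_Mapping.single (x + y) 1 - (Poly_Mapping.single x 1 + Poly_Mapping.single y 1) |x y. True} \<union>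
    {Poly_Mapping.single (s r x) 1 - Poly_Mapping.single x (e r) |r x. True}"

definition tensor_null ::
    "('r \<Rightarrow> 'l::field) \<Rightarrow> ('r \<Rightarrow> 'm::ab_group_add \<Rightarrow> 'm) \<Rightarrow> ('m \<Rightarrow>\<^sub>0 'l) set"
  where "tensor_null e s =
    module.span (\<lambda>l. Poly_Mapping.map ((*) l)) (tensor_relations e s)"

definition bilinear_pairing ::
    "('r::comm_ring_1 \<Rightarrow> 'l::field) \<Rightarrow> ('r \<Rightarrow> 'm::ab_group_add \<Rightarrow> 'm) \<Rightarrow> ('m \<Rightarrow> 'm \<Rightarrow> 'l) \<Rightarrow> bool"
  where "bilinear_pairing e s B \<longleftrightarrow>
    (\<forall>x. module_hom s (algebra_scale e) (\<lambda>y. B x y)) \<and>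
    (\<forall>y. module_hom s (algebra_scale e) (\<lambda>x. B x y))"

definition extend_pairing :: "('m \<Rightarrow> 'm \<Rightarrow> 'l::field) \<Rightarrow> ('m \<Rightarrow>\<^sub>0 'l) \<Rightarrow> ('m \<Rightarrow>\<^sub>0 'l) \<Rightarrow> 'l"
  where "extend_pairing B f g =
    (\<Sum>x\<in>Poly_Mapping.keys f. \<Sum>y\<in>Poly_Mapping.keys g.
      Poly_Mapping.lookup f x * Poly_Mapping.lookup g y * B x y)"

definition nondegenerate_pairing ::
    "('r \<Rightarrow> 'l::field) \<Rightarrow> ('r \<Rightarrow> 'm::ab_group_add \<Rightarrow> 'm) \<Rightarrow> ('m \<Rightarrow> 'm \<Rightarrow> 'l) \<Rightarrow> bool"
  where "nondegenerate_pairing e s B \<longleftrightarrow>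
    (\<forall>f. (\<forall>g. extend_pairing B f g = 0) \<longrightarrow> f \<in> tensor_null e s) \<and>
    (\<forall>g. (\<forall>f. extend_pairing B f g = 0) \<longrightarrow> g \<in> tensor_null e s)"

text \<open>\<open>extend_pairing\<close> is well defined on \<open>L \<otimes>\<^sub>R M\<close>:\<close>

lemma extend_pairing_superset:
  assumes "finite X" "Poly_Mapping.keys f \<subseteq> X"
  shows "extend_pairing B f g =
    (\<Sum>x\<in>X. Poly_Mapping.lookup f x *
      (\<Sum>y\<in>Poly_Mapping.keys g. Poly_Mapping.lookup g y * B x y))"
  unfolding extend_pairing_def using assms
  by (intro sum.mono_neutral_cong_left)
     (auto simp: in_keys_iff sum_distrib_left mult.assoc)

lemma extend_pairing_add:
  "extend_pairing B (f + f') g = extend_pairing B f g + extend_pairing B f' g"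
proof -
  let ?X = "Poly_Mapping.keys f \<union> Poly_Mapping.keys f'"
  have "Poly_Mapping.keys (f + f') \<subseteq> ?X" by (rule Poly_Mapping.keys_add)
  then show ?thesis
    by (simp add: extend_pairing_superset[of ?X] lookup_add distrib_right sum.distrib)
qed

lemma lookup_map_times:
  "Poly_Mapping.lookup (Poly_Mapping.map ((*) l) f) k = l * Poly_Mapping.lookup f k"
  for l :: "'l::field"
  by (simp add: map.rep_eq when_def)

lemma extend_pairing_scale:
  "extend_pairing B (Poly_Mapping.map ((*) l) f) g = l * extend_pairing B f g"
proof -
  have *: "Poly_Mapping.keys (Poly_Mapping.map ((*) l) f) \<subseteq> Poly_Mapping.keys f"
    by (auto simp: in_keys_iff lookup_map_times)
  show ?thesis
    unfolding extend_pairing_superset[OF finite_keys *]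
      extend_pairing_superset[OF finite_keys order_refl, of B f]
    by (simp add: lookup_map_times sum_distrib_left mult.assoc)
qed

lemma extend_pairing_swap: "extend_pairing B f g = extend_pairing (\<lambda>x y. B y x) g f"
  unfolding extend_pairing_def by (subst sum.swap) (simp add: mult.commute)

lemma extend_pairing_null_left:
  fixes s :: "'r::comm_ring_1 \<Rightarrow> 'm::ab_group_add \<Rightarrow> 'm"
  assumes B: "bilinear_pairing e s B" and f: "f \<in> tensor_null e s"
  shows "extend_pairing B f g = 0"
proof -
  have single: "extend_pairing B (Poly_Mapping.single x l) g =
      l * (\<Sum>y\<in>Poly_Mapping.keys g. Poly_Mapping.lookup g y * B x y)" for x l
    by (subst extend_pairing_superset[of "{x}"]) auto
  have diff: "extend_pairing B (u - v) g = extend_pairing B u g - extend_pairing B v g" for u v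
    using extend_pairing_add[of B "u - v" v g] by simp
  have hom: "module_hom s (algebra_scale e) (\<lambda>x. B x y)" for y
    using B by (simp add: bilinear_pairing_def)
  have add: "B (x + x') y = B x y + B x' y" and scl: "B (s r x) y = e r * B x y" for x x' y r
    using module_hom.add[OF hom] module_hom.scale[OF hom] by (auto simp: algebra_scale_def)
  have rel: "extend_pairing B u g = 0" if "u \<in> tensor_relations e s" for u
    using that
    by (auto simp: tensor_relations_def diff extend_pairing_add single add scl
        distrib_left sum.distrib sum_distrib_left mult.left_commute)
  have mod: "module (\<lambda>l. Poly_Mapping.map ((*) l) :: ('m \<Rightarrow>\<^sub>0 'l::field) \<Rightarrow> _)"
    by (unfold_locales; intro poly_mapping_eqI)
       (auto simp: lookup_map_times lookup_add algebra_simps)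
  have "extend_pairing B (\<Sum>u\<in>U. Poly_Mapping.map ((*) (k u)) u) g = 0"
    if "finite U" "U \<subseteq> tensor_relations e s" for U k
    using that
    by (induction U rule: finite_induct)
       (auto simp: extend_pairing_add extend_pairing_scale rel, simp add: extend_pairing_def)
  then show ?thesis
    using f unfolding tensor_null_def module.span_explicit[OF mod] by auto
qed

lemma extend_pairing_null_right:
  assumes "bilinear_pairing e s B" and "g \<in> tensor_null e s"
  shows "extend_pairing B f g = 0"
  using extend_pairing_null_left[of e s "\<lambda>x y. B y x" g f] assms
  by (simp add: extend_pairing_swap[of B] bilinear_pairing_def)


text \<open>
  Below, \<open>e\<close> is the embedding of \<open>R\<close> into \<open>L\<close>. A polarisation need not be symmetric.
\<close>

definition polarisation ::
    "('r::comm_ring_1 \<Rightarrow> 'l::field) \<Rightarrow> ('r \<Rightarrow> 'a::{ring,monoid_mult}) \<Rightarrow> ('a \<Rightarrow> 'a) \<Rightarrow>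
     ('a \<Rightarrow> 'm::ab_group_add \<Rightarrow> 'm) \<Rightarrow> ('c \<Rightarrow> 'm set) \<Rightarrow> ('m \<Rightarrow> 'm \<Rightarrow> 'l) \<Rightarrow> bool"
  where "polarisation e \<phi> \<iota> act M B \<longleftrightarrow>
    bilinear_pairing e (restrict_scale \<phi> act) B \<and>
    nondegenerate_pairing e (restrict_scale \<phi> act) B \<and>
    (\<forall>c c'. c \<noteq> c' \<longrightarrow> (\<forall>x\<in>M c. \<forall>y\<in>M c'. B x y = 0)) \<and>
    (\<forall>a x y. B (act a x) y = B x (act (\<iota> a) y))"

definition polarisable ::
    "('r::comm_ring_1 \<Rightarrow> 'l::field) \<Rightarrow> ('r \<Rightarrow> 'a::{ring,monoid_mult}) \<Rightarrow> ('a \<Rightarrow> 'a) \<Rightarrow>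
     ('a \<Rightarrow> 'm::ab_group_add \<Rightarrow> 'm) \<Rightarrow> ('c \<Rightarrow> 'm set) \<Rightarrow> bool"
  where "polarisable e \<phi> \<iota> act M \<longleftrightarrow> (\<exists>B. polarisation e \<phi> \<iota> act M B)"

end

theory Submission
  imports Defs "Jordan_Normal_Form.Determinant" "HOL-Library.Function_Algebras"
begin

text \<open>
  Let \<open>Q\<close> be the fraction field of \<open>R\<close> and \<open>V = Q \<otimes>\<^sub>R M\<close>, which is finite-dimensional because \<open>M\<close> is
  finitely generated over \<open>R\<close>. In terms of a basis of \<open>V\<close> taken from \<open>M\<close>, a pairing with values in
  \<open>L\<close> is a Gram matrix \<open>G\<close> over \<open>L\<close>, and it is non-degenerate exactly when \<open>det G \<noteq> 0\<close>
  (lemma \<open>nondegenerate_iff\<close>). That \<open>a\<close> is adjoint to \<open>\<iota> a\<close> reads \<open>\<rho>(a)\<^sup>T G = G \<rho>(\<iota> a)\<close>, where \<open>\<rho>(a)\<close>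
  is the matrix of \<open>a\<close>. That the homogeneous components are orthogonal means that each projection
  onto a component is self-adjoint, which is a condition \<open>E\<^sup>T G = G E\<close> of the same shape. Hence
  polarisations over \<open>L\<close> are the invertible matrices \<open>G\<close> over \<open>L\<close> with \<open>X G = G Y\<close> for all \<open>(X, Y)\<close>
  in a set \<open>P\<close> of pairs of matrices over \<open>Q\<close> that does not depend on \<open>L\<close>
  (lemma \<open>polarisable_iff_matrix\<close>).

  It remains to show that the existence of an invertible intertwining matrix for \<open>P\<close> descends along
  a field extension \<open>j : F \<rightarrow> L\<close>; this is the Noether--Deuring theorem (lemma \<open>noether_deuring\<close>). A
  solution \<open>G\<close> over \<open>L\<close> is a combination \<open>\<Sum>b b H\<^sub>b\<close> of solutions \<open>H\<^sub>b\<close> over \<open>F\<close>, where \<open>b\<close> runs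
  over elements of \<open>L\<close> that are linearly independent over \<open>F\<close>.

  If \<open>F\<close> is infinite, the polynomial \<open>det (\<Sum>b x\<^sub>b H\<^sub>b)\<close> does not vanish at \<open>x\<^sub>b = b\<close>, so it
  does not vanish at some point with coordinates in \<open>F\<close>. Replacing the coordinates one at a time
  needs only the finiteness of the set of roots of a polynomial in one variable.

  If \<open>F\<close> is finite, count as in Lovasz's cancellation theorem. For a set \<open>K\<close> of vectors, compare the
  intertwining matrices for \<open>P\<close> that kill \<open>K\<close> with the endomorphisms that kill \<open>K\<close>, that is, the
  matrices commuting with all \<open>Y\<close>. Both are solution spaces of linear systems over \<open>F\<close>, and over \<open>L\<close>
  multiplication by \<open>G\<close> is an isomorphism between them. So they have the same dimension, hence the
  same finite cardinality, for each \<open>K\<close>. By inversion over the subsets of \<open>F\<^sup>n\<close>, for each \<open>K\<close> as many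
  intertwining matrices as endomorphisms have kernel exactly \<open>K\<close>. The identity is an endomorphism with
  kernel \<open>{0}\<close>, so there is an intertwining matrix with kernel \<open>{0}\<close>.
\<close>

section \<open>Intertwining matrices and extension of scalars\<close>

text \<open>
  The matrices \<open>G\<close> with \<open>X G = G Y\<close> for all \<open>(X, Y) \<in> P\<close> that kill all vectors in \<open>K\<close>: homomorphisms
  from \<open>F\<^sup>n\<close>, with the \<open>Y\<close> as operators, to \<open>F\<^sup>n\<close>, with the \<open>X\<close> as operators, that vanish on \<open>K\<close>.
\<close>

definition intertwiners ::
    "nat \<Rightarrow> ('f::field mat \<times> 'f mat) set \<Rightarrow> 'f vec set \<Rightarrow> 'f mat set"
  where "intertwiners n P K =
    {G \<in> carrier_mat n n. (\<forall>(X, Y)\<in>P. X * G = G * Y) \<and> (\<forall>k\<in>K. G *\<^sub>v k = 0\<^sub>v n)}"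

text \<open>
  A basis \<open>\<beta>\<close>, over the smaller field, of the span of finitely many elements of \<open>L\<close>, with the
  coordinates \<open>c x\<close> of these elements.
\<close>

lemma scalar_decomposition:
  fixes j :: "'f::field \<Rightarrow> 'l::field"
  assumes j: "field_hom j" and X: "finite X"
  obtains \<beta> c where "finite \<beta>"
    and "\<And>x. x \<in> X \<Longrightarrow> x = (\<Sum>b\<in>\<beta>. b * j (c x b))"
    and "\<And>q b. (\<Sum>b\<in>\<beta>. b * j (q b)) = 0 \<Longrightarrow> b \<in> \<beta> \<Longrightarrow> q b = 0"
proof -
  interpret j: field_hom j by fact
  interpret V: vector_space "\<lambda>q l. j q * l"
    by unfold_locales (simp_all add: algebra_simps j.hom_add j.hom_mult)
  obtain \<beta> where \<beta>: "\<beta> \<subseteq> X" "V.independent \<beta>" "X \<subseteq> V.span \<beta>"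
    by (rule V.maximal_independent_subset)
  have fin: "finite \<beta>" using \<beta>(1) X finite_subset by blast
  have "\<exists>c. x = (\<Sum>b\<in>\<beta>. j (c b) * b)" if "x \<in> X" for x
    using that \<beta>(3) unfolding V.span_finite[OF fin] by auto
  then obtain c where c: "\<And>x. x \<in> X \<Longrightarrow> x = (\<Sum>b\<in>\<beta>. j (c x b) * b)"
    by metis
  show thesis
  proof (rule that[OF fin])
    show "x = (\<Sum>b\<in>\<beta>. b * j (c x b))" if "x \<in> X" for x
      using c[OF that] by (simp add: mult.commute)
    show "q b = 0" if "(\<Sum>b\<in>\<beta>. b * j (q b)) = 0" "b \<in> \<beta>" for q b
      using V.independentD[OF \<beta>(2) fin order_refl, of q b] that by (simp add: mult.commute)
  qed
qed

lemma index_mult_mat_sum: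
  assumes "A \<in> carrier_mat n n" "B \<in> carrier_mat n n" "i < n" "k < n"
  shows "(A * B) $$ (i, k) = (\<Sum>m<n. A $$ (i, m) * B $$ (m, k))"
  using assms by (simp add: scalar_prod_def atLeast0LessThan)

lemma index_mult_mat_vec_sum:
  assumes "A \<in> carrier_mat n n" "v \<in> carrier_vec n" "i < n"
  shows "(A *\<^sub>v v) $ i = (\<Sum>m<n. A $$ (i, m) * v $ m)"
  using assms by (simp add: scalar_prod_def atLeast0LessThan)

text \<open>
  If a matrix over \<open>L\<close> satisfies linear conditions with coefficients in the smaller field, so does
  each of its coordinate matrices with respect to a basis \<open>\<beta>\<close> of the span of its entries.
\<close>

lemma intertwiners_decompose:
  fixes j :: "'f::field \<Rightarrow> 'l::field"
  assumes j: "field_hom j"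
    and P: "P \<subseteq> carrier_mat n n \<times> carrier_mat n n" and K: "K \<subseteq> carrier_vec n"
    and G: "G \<in> intertwiners n (map_prod (map_mat j) (map_mat j) ` P) (map_vec j ` K)"
  obtains \<beta> H where "finite \<beta>" "\<And>b. b \<in> \<beta> \<Longrightarrow> H b \<in> intertwiners n P K"
    "\<And>i k. i < n \<Longrightarrow> k < n \<Longrightarrow> G $$ (i, k) = (\<Sum>b\<in>\<beta>. b * j (H b $$ (i, k)))"
proof -
  interpret j: field_hom j by fact
  let ?E = "(\<lambda>(i, k). G $$ (i, k)) ` ({..<n} \<times> {..<n})"
  obtain \<beta> c where \<beta>: "finite \<beta>"
    and c: "\<And>x. x \<in> ?E \<Longrightarrow> x = (\<Sum>b\<in>\<beta>. b * j (c x b))"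
    and indep: "\<And>q b. (\<Sum>b\<in>\<beta>. b * j (q b)) = 0 \<Longrightarrow> b \<in> \<beta> \<Longrightarrow> q b = 0"
    by (rule scalar_decomposition[OF j, of ?E]) auto
  define H where "H b = mat n n (\<lambda>(i, k). c (G $$ (i, k)) b)" for b
  have H: "H b \<in> carrier_mat n n" for b by (simp add: H_def)
  have GH: "G $$ (i, k) = (\<Sum>b\<in>\<beta>. b * j (H b $$ (i, k)))" if "i < n" "k < n" for i k
    using c[of "G $$ (i, k)"] that by (force simp: H_def)
  have G0: "G \<in> carrier_mat n n"
    and GP: "\<And>X Y. (X, Y) \<in> P \<Longrightarrow> map_mat j X * G = G * map_mat j Y"
    and GK: "\<And>k. k \<in> K \<Longrightarrow> G *\<^sub>v map_vec j k = 0\<^sub>v n"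
    using G by (force simp: intertwiners_def)+
  have "H b \<in> intertwiners n P K" if b: "b \<in> \<beta>" for b
    unfolding intertwiners_def
  proof (safe)
    show "H b \<in> carrier_mat n n" by (rule H)
    fix X Y assume XY: "(X, Y) \<in> P"
    then have X: "X \<in> carrier_mat n n" and Y: "Y \<in> carrier_mat n n" using P by auto
    show "X * H b = H b * Y"
    proof (rule eq_matI)
      fix i k assume "i < dim_row (H b * Y)" "k < dim_col (H b * Y)"
      then have ik: "i < n" "k < n" using H Y by (auto simp: H_def)
      have "(map_mat j X * G) $$ (i, k) = (\<Sum>b\<in>\<beta>. b * j ((X * H b) $$ (i, k)))"
      proof -
        have "(map_mat j X * G) $$ (i, k) = (\<Sum>m<n. j (X $$ (i, m)) * G $$ (m, k))"
          using X G0 ik by (subst index_mult_mat_sum[of _ n]) auto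
        also have "\<dots> = (\<Sum>m<n. \<Sum>b\<in>\<beta>. j (X $$ (i, m)) * (b * j (H b $$ (m, k))))"
          using ik by (simp add: GH sum_distrib_left)
        also have "\<dots> = (\<Sum>b\<in>\<beta>. b * j ((X * H b) $$ (i, k)))"
          using ik by (subst sum.swap)
            (simp add: index_mult_mat_sum[OF X H] j.hom_sum j.hom_mult sum_distrib_left ac_simps)
        finally show ?thesis .
      qed
      moreover have "(G * map_mat j Y) $$ (i, k) = (\<Sum>b\<in>\<beta>. b * j ((H b * Y) $$ (i, k)))"
      proof -
        have "(G * map_mat j Y) $$ (i, k) = (\<Sum>m<n. G $$ (i, m) * j (Y $$ (m, k)))"
          using Y G0 ik by (subst index_mult_mat_sum[of _ n]) auto
        also have "\<dots> = (\<Sum>m<n. \<Sum>b\<in>\<beta>. b * j (H b $$ (i, m)) * j (Y $$ (m, k)))"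
          using ik by (simp add: GH sum_distrib_right)
        also have "\<dots> = (\<Sum>b\<in>\<beta>. b * j ((H b * Y) $$ (i, k)))"
          using ik by (subst sum.swap)
            (simp add: index_mult_mat_sum[OF H Y] j.hom_sum j.hom_mult sum_distrib_left ac_simps)
        finally show ?thesis .
      qed
      ultimately have "(\<Sum>b\<in>\<beta>. b * j ((X * H b) $$ (i, k) - (H b * Y) $$ (i, k))) = 0"
        using GP[OF XY] by (simp add: j.hom_minus right_diff_distrib sum_subtractf)
      from indep[OF this b] show "(X * H b) $$ (i, k) = (H b * Y) $$ (i, k)" by simp
    qed (use X Y H in \<open>auto simp: H_def\<close>)
  next
    fix k assume "k \<in> K"
    then have k: "k \<in> carrier_vec n" "k \<in> K" using K by auto
    show "H b *\<^sub>v k = 0\<^sub>v n"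
    proof (rule eq_vecI)
      fix i assume "i < dim_vec (0\<^sub>v n :: 'f vec)"
      then have i: "i < n" by simp
      have "0 = (G *\<^sub>v map_vec j k) $ i" using GK k i by simp
      also have "\<dots> = (\<Sum>m<n. G $$ (i, m) * j (k $ m))"
        using k G0 i by (subst index_mult_mat_vec_sum[of _ n]) auto
      also have "\<dots> = (\<Sum>m<n. \<Sum>b\<in>\<beta>. b * j (H b $$ (i, m)) * j (k $ m))"
        using i by (simp add: GH sum_distrib_right)
      also have "\<dots> = (\<Sum>b\<in>\<beta>. b * j ((H b *\<^sub>v k) $ i))"
        using i k by (subst sum.swap)
          (simp add: index_mult_mat_vec_sum[OF H k(1)] j.hom_sum j.hom_mult sum_distrib_left ac_simps)
      finally have "(H b *\<^sub>v k) $ i = 0" using indep[OF _ b] by simp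
      then show "(H b *\<^sub>v k) $ i = 0\<^sub>v n $ i" using i by simp
    qed (use H in \<open>auto simp: H_def\<close>)
  qed
  then show thesis using that[OF \<beta> _ GH] by blast
qed

lemma intertwiner_sum:
  assumes P: "P \<subseteq> carrier_mat n n \<times> carrier_mat n n" and K: "K \<subseteq> carrier_vec n"
    and H: "\<And>b. b \<in> \<beta> \<Longrightarrow> H b \<in> intertwiners n P K"
  shows "mat n n (\<lambda>ik. \<Sum>b\<in>\<beta>. q b * H b $$ ik) \<in> intertwiners n P K" (is "?S \<in> _")
  unfolding intertwiners_def
proof safe
  have Hc: "\<And>b. b \<in> \<beta> \<Longrightarrow> H b \<in> carrier_mat n n" using H by (auto simp: intertwiners_def)
  show S: "?S \<in> carrier_mat n n" by simp
  fix X Y assume XY: "(X, Y) \<in> P"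
  then have X: "X \<in> carrier_mat n n" and Y: "Y \<in> carrier_mat n n" using P by auto
  show "X * ?S = ?S * Y"
  proof (rule eq_matI)
    fix i k assume "i < dim_row (?S * Y)" "k < dim_col (?S * Y)"
    then have ik: "i < n" "k < n" using Y by auto
    have "(X * ?S) $$ (i, k) = (\<Sum>b\<in>\<beta>. q b * (X * H b) $$ (i, k))"
      using ik Hc by (subst index_mult_mat_sum[OF X S ik])
        (simp add: sum_distrib_left index_mult_mat_sum[OF X] sum.swap[of _ _ \<beta>] ac_simps)
    also have "\<dots> = (\<Sum>b\<in>\<beta>. q b * (H b * Y) $$ (i, k))"
    proof (intro sum.cong refl arg_cong2[where f = times])
      fix b assume "b \<in> \<beta>"
      from H[OF this] XY show "(X * H b) $$ (i, k) = (H b * Y) $$ (i, k)"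
        by (force simp: intertwiners_def)
    qed
    also have "\<dots> = (?S * Y) $$ (i, k)"
      using ik Hc by (subst index_mult_mat_sum[OF S Y ik])
        (simp add: sum_distrib_left sum_distrib_right index_mult_mat_sum[OF _ Y] sum.swap[of _ _ \<beta>] ac_simps)
    finally show "(X * ?S) $$ (i, k) = (?S * Y) $$ (i, k)" .
  qed (use X Y in auto)
next
  have Hc: "\<And>b. b \<in> \<beta> \<Longrightarrow> H b \<in> carrier_mat n n" using H by (auto simp: intertwiners_def)
  have S: "?S \<in> carrier_mat n n" by simp
  fix k assume "k \<in> K"
  then have k: "k \<in> carrier_vec n" "k \<in> K" using K by auto
  show "?S *\<^sub>v k = 0\<^sub>v n"
  proof (rule eq_vecI)
    fix i assume "i < dim_vec (0\<^sub>v n :: 'a vec)"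
    then have i: "i < n" by simp
    have "(?S *\<^sub>v k) $ i = (\<Sum>b\<in>\<beta>. q b * (H b *\<^sub>v k) $ i)"
      using i Hc by (subst index_mult_mat_vec_sum[OF S k(1) i])
        (simp add: sum_distrib_left sum_distrib_right index_mult_mat_vec_sum[OF _ k(1)]
          sum.swap[of _ _ \<beta>] ac_simps)
    also have "\<dots> = 0" using H k i by (intro sum.neutral) (auto simp: intertwiners_def)
    finally show "(?S *\<^sub>v k) $ i = 0\<^sub>v n $ i" using i by simp
  qed auto
qed

lemma map_mat_intertwiners:
  fixes j :: "'f::field \<Rightarrow> 'l::field"
  assumes j: "field_hom j"
    and P: "P \<subseteq> carrier_mat n n \<times> carrier_mat n n" and K: "K \<subseteq> carrier_vec n"
    and H: "H \<in> intertwiners n P K"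
  shows "map_mat j H \<in> intertwiners n (map_prod (map_mat j) (map_mat j) ` P) (map_vec j ` K)"
proof -
  interpret j: field_hom j by fact
  have Hc: "H \<in> carrier_mat n n" using H by (simp add: intertwiners_def)
  show ?thesis
    unfolding intertwiners_def
  proof safe
    show "map_mat j H \<in> carrier_mat n n" using Hc by simp
  next
    fix X Y assume XY: "(X, Y) \<in> P"
    then have c: "X \<in> carrier_mat n n" "Y \<in> carrier_mat n n" using P by auto
    have "X * H = H * Y" using H XY by (force simp: intertwiners_def)
    then show "map_mat j X * map_mat j H = map_mat j H * map_mat j Y"
      using j.mat_hom_mult[OF c(1) Hc] j.mat_hom_mult[OF Hc c(2)] by simp
  next
    have j0: "map_vec j (0\<^sub>v n) = 0\<^sub>v n" by (rule eq_vecI) auto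
    fix k assume "k \<in> K"
    then have "k \<in> carrier_vec n" "H *\<^sub>v k = 0\<^sub>v n" using H K by (auto simp: intertwiners_def)
    then show "map_mat j H *\<^sub>v map_vec j k = 0\<^sub>v n"
      using j.mult_mat_vec_hom[OF Hc, of k] by (metis j0)
  qed
qed

section \<open>Descent over an infinite field\<close>

text \<open>
  The affine summand \<open>h\<close> absorbs the variables that have already been specialised.
\<close>

lemma det_nonzero_specialise:
  fixes j :: "'f::field \<Rightarrow> 'l::field"
  assumes j: "field_hom j" and inf: "infinite (UNIV :: 'f set)" and "finite \<beta>"
    and "det (mat n n (\<lambda>ik. h ik + (\<Sum>b\<in>\<beta>. x b * j (g b ik)))) \<noteq> 0"
  shows "\<exists>q. det (mat n n (\<lambda>ik. h ik + (\<Sum>b\<in>\<beta>. j (q b) * j (g b ik)))) \<noteq> 0"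
  using assms(3,4)
proof (induction \<beta> arbitrary: h rule: finite_induct)
  case empty
  then show ?case by simp
next
  case (insert a \<beta>)
  interpret j: field_hom j by fact
  let ?h = "\<lambda>ik. h ik + (\<Sum>b\<in>\<beta>. x b * j (g b ik))"
  \<comment> \<open>The determinant as a polynomial in the variable at \<open>a\<close>, the others being kept at \<open>x\<close>.\<close>
  define p where "p = det (mat n n (\<lambda>ik. [:?h ik, j (g a ik):]))"
  have p: "poly p t = det (mat n n (\<lambda>ik. ?h ik + t * j (g a ik)))" for t
  proof -
    interpret ev: comm_ring_hom "\<lambda>p. poly p t" by unfold_locales auto
    have "poly p t = det (map_mat (\<lambda>p. poly p t) (mat n n (\<lambda>ik. [:?h ik, j (g a ik):])))"
      by (simp add: p_def)
    also have "map_mat (\<lambda>p. poly p t) (mat n n (\<lambda>ik. [:?h ik, j (g a ik):])) =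
        mat n n (\<lambda>ik. ?h ik + t * j (g a ik))"
      by (rule eq_matI) auto
    finally show ?thesis .
  qed
  have "poly p (x a) \<noteq> 0"
    using insert by (simp add: p algebra_simps)
  then have "finite {t. poly p t = 0}" by (metis poly_0 poly_roots_finite)
  moreover have "infinite (range j)"
    using inf j.injectivity by (auto simp: finite_image_iff inj_on_def)
  ultimately obtain q where q: "poly p (j q) \<noteq> 0"
    by (metis (mono_tags, lifting) finite_subset mem_Collect_eq rangeE subsetI)
  let ?h' = "\<lambda>ik. h ik + j q * j (g a ik)"
  have "det (mat n n (\<lambda>ik. ?h' ik + (\<Sum>b\<in>\<beta>. x b * j (g b ik)))) \<noteq> 0"
    using q by (simp add: p algebra_simps)
  from insert.IH[OF this] obtain q'
    where "det (mat n n (\<lambda>ik. ?h' ik + (\<Sum>b\<in>\<beta>. j (q' b) * j (g b ik)))) \<noteq> 0" by blast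
  moreover have "(\<Sum>b\<in>\<beta>. j ((q'(a := q)) b) * j (g b ik)) = (\<Sum>b\<in>\<beta>. j (q' b) * j (g b ik))" for ik
    using insert.hyps by (intro sum.cong) auto
  ultimately show ?case
    using insert.hyps by (intro exI[of _ "q'(a := q)"]) (simp add: algebra_simps)
qed

lemma noether_deuring_infinite:
  fixes j :: "'f::field \<Rightarrow> 'l::field"
  assumes j: "field_hom j" and inf: "infinite (UNIV :: 'f set)"
    and P: "P \<subseteq> carrier_mat n n \<times> carrier_mat n n"
    and G: "G \<in> intertwiners n (map_prod (map_mat j) (map_mat j) ` P) {}" "det G \<noteq> 0"
  shows "\<exists>H \<in> intertwiners n P {}. det H \<noteq> 0"
proof -
  interpret j: field_hom j by fact
  obtain \<beta> H where \<beta>: "finite \<beta>" and H: "\<And>b. b \<in> \<beta> \<Longrightarrow> H b \<in> intertwiners n P {}"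
    and GH: "\<And>i k. i < n \<Longrightarrow> k < n \<Longrightarrow> G $$ (i, k) = (\<Sum>b\<in>\<beta>. b * j (H b $$ (i, k)))"
    by (rule intertwiners_decompose[OF j P, of "{}" G]) (use G in auto)
  have "G = mat n n (\<lambda>ik. 0 + (\<Sum>b\<in>\<beta>. b * j (H b $$ ik)))"
    using G GH by (intro eq_matI) (auto simp: intertwiners_def)
  with G obtain q where
    q: "det (mat n n (\<lambda>ik. 0 + (\<Sum>b\<in>\<beta>. j (q b) * j (H b $$ ik)))) \<noteq> 0"
    using det_nonzero_specialise[OF j inf \<beta>, of n "\<lambda>_. 0" "\<lambda>b. b" "\<lambda>b ik. H b $$ ik"] by auto
  let ?S = "mat n n (\<lambda>ik. \<Sum>b\<in>\<beta>. q b * H b $$ ik)"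
  have "mat n n (\<lambda>ik. 0 + (\<Sum>b\<in>\<beta>. j (q b) * j (H b $$ ik))) = map_mat j ?S"
    by (rule eq_matI) (auto simp: j.hom_sum j.hom_mult)
  with q have "det ?S \<noteq> 0" by auto
  moreover have "?S \<in> intertwiners n P {}" by (rule intertwiner_sum[OF P _ H]) auto
  ultimately show ?thesis by blast
qed

section \<open>Descent over a finite field\<close>

text \<open>
  Inversion over the lattice of subsets of a finite set: the numbers of elements with \<open>K\<close>
  contained in the kernel, for all \<open>K\<close>, determine the numbers of elements with kernel equal to \<open>K\<close>.
\<close>

lemma intertwiner_counting:
  fixes S1 :: "'s set" and S2 :: "'t set" and k1 :: "'s \<Rightarrow> 'v set" and k2 :: "'t \<Rightarrow> 'v set"
  assumes fin: "finite S1" "finite S2" "finite V"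
    and k: "\<And>s. s \<in> S1 \<Longrightarrow> k1 s \<subseteq> V" "\<And>s. s \<in> S2 \<Longrightarrow> k2 s \<subseteq> V"
    and eq: "\<And>K. K \<subseteq> V \<Longrightarrow> card {s \<in> S1. K \<subseteq> k1 s} = card {s \<in> S2. K \<subseteq> k2 s}"
    and K: "K \<subseteq> V"
  shows "card {s \<in> S1. k1 s = K} = card {s \<in> S2. k2 s = K}"
  using K
proof (induction "card (V - K)" arbitrary: K rule: less_induct)
  case less
  have split: "card {s \<in> S. K \<subseteq> f s} =
      card {s \<in> S. f s = K} + (\<Sum>K'\<in>{K'. K \<subset> K' \<and> K' \<subseteq> V}. card {s \<in> S. f s = K'})"
    if "finite S" "\<And>s. s \<in> S \<Longrightarrow> f s \<subseteq> V" for f :: "'b \<Rightarrow> 'v set" and S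
  proof -
    have finK: "finite {K'. K \<subset> K' \<and> K' \<subseteq> V}"
      using fin(3) by (rule rev_finite_subset[OF finite_Pow_iff[THEN iffD2]]) auto
    have "{s \<in> S. K \<subseteq> f s} =
        {s \<in> S. f s = K} \<union> (\<Union>K'\<in>{K'. K \<subset> K' \<and> K' \<subseteq> V}. {s \<in> S. f s = K'})"
      using that(2) by auto
    also have "card \<dots> = card {s \<in> S. f s = K} +
        card (\<Union>K'\<in>{K'. K \<subset> K' \<and> K' \<subseteq> V}. {s \<in> S. f s = K'})"
      using finK that(1) by (intro card_Un_disjoint) auto
    also have "card (\<Union>K'\<in>{K'. K \<subset> K' \<and> K' \<subseteq> V}. {s \<in> S. f s = K'}) =
        (\<Sum>K'\<in>{K'. K \<subset> K' \<and> K' \<subseteq> V}. card {s \<in> S. f s = K'})"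
      using finK that(1) by (intro card_UN_disjoint) auto
    finally show ?thesis .
  qed
  have "(\<Sum>K'\<in>{K'. K \<subset> K' \<and> K' \<subseteq> V}. card {s \<in> S1. k1 s = K'}) =
      (\<Sum>K'\<in>{K'. K \<subset> K' \<and> K' \<subseteq> V}. card {s \<in> S2. k2 s = K'})"
  proof (rule sum.cong[OF refl])
    fix K' assume "K' \<in> {K'. K \<subset> K' \<and> K' \<subseteq> V}"
    then have K': "K \<subset> K'" "K' \<subseteq> V" by auto
    then have "V - K' \<subset> V - K" by auto
    then have "card (V - K') < card (V - K)" using fin(3) by (intro psubset_card_mono) auto
    from less.hyps[OF this K'(2)]
    show "card {s \<in> S1. k1 s = K'} = card {s \<in> S2. k2 s = K'}" .
  qed
  with split[of S1 k1] split[of S2 k2] fin k eq[OF less.prems] show ?case by simp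
qed

text \<open>
  The entries of an \<open>n \<times> n\<close> matrix as a function on all of \<open>nat \<times> nat\<close>, extended by \<open>0\<close>. This
  makes matrices elements of a vector space whose carrier is a whole type.
\<close>

definition entries :: "nat \<Rightarrow> 'f::zero mat \<Rightarrow> nat \<times> nat \<Rightarrow> 'f"
  where "entries n G ik = (if ik \<in> {..<n} \<times> {..<n} then G $$ ik else 0)"

lemma mat_entries: "G \<in> carrier_mat n n \<Longrightarrow> mat n n (entries n G) = G"
  by (intro eq_matI) (auto simp: entries_def)

lemma inj_on_entries: "inj_on (entries n) (carrier_mat n n)"
  by (metis inj_onI mat_entries)

lemma entries_mat: "(\<And>ik. ik \<notin> {..<n} \<times> {..<n} \<Longrightarrow> g ik = 0) \<Longrightarrow> entries n (mat n n g) = g"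
  by (rule ext) (auto simp: entries_def)

lemma sum_fun_apply: "sum f A x = (\<Sum>a\<in>A. f a x)"
  by (induction A rule: infinite_finite_induct) auto

lemma vector_space_functions: "vector_space (\<lambda>c (f :: 'i \<Rightarrow> 'f::field) i. c * f i)"
  by unfold_locales (auto simp: algebra_simps)

text \<open>
  A vector space of dimension \<open>m\<close> over a field with \<open>q\<close> elements has \<open>q ^ m\<close> elements.
\<close>

lemma intertwiners_basis:
  fixes P :: "('f::field mat \<times> 'f mat) set"
  assumes F: "finite (UNIV :: 'f set)"
    and P: "P \<subseteq> carrier_mat n n \<times> carrier_mat n n" and K: "K \<subseteq> carrier_vec n"
  obtains B where "finite B"
    "module.independent (\<lambda>c (f :: nat \<times> nat \<Rightarrow> 'f) i. c * f i) B"
    "module.span (\<lambda>c f i. c * f i) B = entries n ` intertwiners n P K"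
    "card (intertwiners n P K) = card (UNIV :: 'f set) ^ card B"
proof -
  interpret V: vector_space "\<lambda>c (f :: nat \<times> nat \<Rightarrow> 'f) i. c * f i"
    by (rule vector_space_functions)
  let ?I = "intertwiners n P K" and ?W = "entries n ` intertwiners n P K"
  have Ic: "?I \<subseteq> carrier_mat n n" by (auto simp: intertwiners_def)
  have sub: "V.subspace ?W"
  proof (rule V.subspaceI)
    let ?Z = "mat n n (\<lambda>ik. \<Sum>b\<in>({} :: nat set). (0 :: 'f) * 0\<^sub>m n n $$ ik)"
    have "?Z \<in> ?I" by (rule intertwiner_sum[OF P K]) simp
    moreover have "0 = entries n ?Z" by (simp add: entries_def fun_eq_iff)
    ultimately show "0 \<in> ?W" by (rule rev_image_eqI)
    fix x y assume "x \<in> ?W" "y \<in> ?W"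
    then obtain G H where G: "G \<in> ?I" "x = entries n G" and H: "H \<in> ?I" "y = entries n H" by auto
    let ?X = "mat n n (\<lambda>ik. \<Sum>b\<in>{False, True}. 1 * (if b then G else H) $$ ik)"
    have "?X \<in> ?I" by (rule intertwiner_sum[OF P K]) (use G H in auto)
    moreover have "x + y = entries n ?X"
      by (simp add: G(2) H(2) entries_def fun_eq_iff)
    ultimately show "x + y \<in> ?W" by (rule rev_image_eqI)
    fix c
    let ?X = "mat n n (\<lambda>ik. \<Sum>b\<in>{True}. c * G $$ ik)"
    have "?X \<in> ?I" by (rule intertwiner_sum[OF P K]) (use G in auto)
    moreover have "(\<lambda>i. c * x i) = entries n ?X"
      by (simp add: G(2) entries_def fun_eq_iff)
    ultimately show "(\<lambda>i. c * x i) \<in> ?W" by (rule rev_image_eqI)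
  qed
  obtain B where B: "B \<subseteq> ?W" "V.independent B" "?W \<subseteq> V.span B"
    by (rule V.maximal_independent_subset)
  have span: "V.span B = ?W"
    using B sub by (intro V.span_subspace)
  have "finite (({..<n} \<times> {..<n}) \<rightarrow>\<^sub>E (UNIV :: 'f set))" using F by (intro finite_PiE) auto
  then have "finite ((\<lambda>f ik. if ik \<in> {..<n} \<times> {..<n} then f ik else 0) `
      (({..<n} \<times> {..<n}) \<rightarrow>\<^sub>E (UNIV :: 'f set)))" by (rule finite_imageI)
  moreover have "?W \<subseteq> (\<lambda>f ik. if ik \<in> {..<n} \<times> {..<n} then f ik else 0) `
      (({..<n} \<times> {..<n}) \<rightarrow>\<^sub>E (UNIV :: 'f set))"
  proof
    fix x assume "x \<in> ?W"
    then obtain G where "x = entries n G" by auto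
    then have "x = (\<lambda>ik. if ik \<in> {..<n} \<times> {..<n} then
        restrict (\<lambda>ik. G $$ ik) ({..<n} \<times> {..<n}) ik else 0)"
      by (auto simp: entries_def fun_eq_iff)
    then show "x \<in> (\<lambda>f ik. if ik \<in> {..<n} \<times> {..<n} then f ik else 0) `
      (({..<n} \<times> {..<n}) \<rightarrow>\<^sub>E (UNIV :: 'f set))" 
      by (rule image_eqI[where x = "restrict (\<lambda>ik. G $$ ik) ({..<n} \<times> {..<n})"]) auto
  qed
  ultimately have "finite ?W" by (rule rev_finite_subset)
  then have fin: "finite B" using B(1) finite_subset by blast
  let ?L = "\<lambda>u. \<Sum>b\<in>B. (\<lambda>i. u b * b i)"
  have "bij_betw ?L (B \<rightarrow>\<^sub>E UNIV) ?W"
    unfolding bij_betw_def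
  proof
    show "inj_on ?L (B \<rightarrow>\<^sub>E UNIV)"
    proof (rule inj_onI)
      fix u v assume uv: "u \<in> B \<rightarrow>\<^sub>E UNIV" "v \<in> B \<rightarrow>\<^sub>E UNIV" "?L u = ?L v"
      have "?L (\<lambda>b. u b - v b) = 0"
        using uv(3) by (simp add: V.scale_left_diff_distrib sum_subtractf)
      then have "u b = v b" if "b \<in> B" for b
        using V.independentD[OF B(2) fin order_refl, of "\<lambda>b. u b - v b"] that by simp
      then show "u = v" using uv by (intro PiE_ext[of u B _ v])
    qed
    show "?L ` (B \<rightarrow>\<^sub>E UNIV) = ?W"
      unfolding span[symmetric] V.span_finite[OF fin]
    proof safe
      fix u :: "_ \<Rightarrow> 'f"
      have "?L u = ?L (restrict u B)" by (intro sum.cong) auto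
      then show "?L u \<in> ?L ` (B \<rightarrow>\<^sub>E UNIV)"
        by (rule image_eqI[where x = "restrict u B"]) auto
    qed auto
  qed
  then have "card ?W = card (UNIV :: 'f set) ^ card B"
    using fin by (simp add: bij_betw_same_card[symmetric] card_PiE)
  moreover have "card ?W = card ?I"
    using Ic by (intro card_image inj_on_subset[OF inj_on_entries])
  ultimately show thesis using that[OF fin B(2) span] by simp
qed

text \<open>
  Expanding the coefficients of a relation over \<open>L\<close> in a basis over the smaller field gives
  relations over the smaller field.
\<close>

lemma independent_field_extension:
  fixes j :: "'f::field \<Rightarrow> 'l::field" and B :: "('i \<Rightarrow> 'f) set"
  assumes j: "field_hom j" and fin: "finite B"
    and B: "module.independent (\<lambda>c f i. c * f i) B"
  shows "module.independent (\<lambda>c f i. c * f i) ((\<circ>) j ` B)"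
proof -
  interpret j: field_hom j by fact
  interpret V: vector_space "\<lambda>c (f :: 'i \<Rightarrow> 'f) i. c * f i"
    by (rule vector_space_functions)
  interpret W: vector_space "\<lambda>c (f :: 'i \<Rightarrow> 'l) i. c * f i"
    by (rule vector_space_functions)
  have inj: "inj ((\<circ>) j :: ('i \<Rightarrow> 'f) \<Rightarrow> _)"
    by (auto simp: inj_def fun_eq_iff)
  have "u (j \<circ> a) = 0"
    if "(\<Sum>v\<in>(\<circ>) j ` B. (\<lambda>i. u v * v i)) = 0" and a: "a \<in> B" for u a
  proof -
    obtain \<beta> c where \<beta>: "finite \<beta>"
      and c: "\<And>x. x \<in> (\<lambda>b. u (j \<circ> b)) ` B \<Longrightarrow> x = (\<Sum>b\<in>\<beta>. b * j (c x b))"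
      and indep: "\<And>q b. (\<Sum>b\<in>\<beta>. b * j (q b)) = 0 \<Longrightarrow> b \<in> \<beta> \<Longrightarrow> q b = 0"
      by (rule scalar_decomposition[OF j, of "(\<lambda>b. u (j \<circ> b)) ` B"]) (use fin in auto)
    have "(\<Sum>v\<in>B. u (j \<circ> v) * j (v i)) = 0" for i
    proof -
      have "(\<Sum>v\<in>(\<circ>) j ` B. (\<lambda>i. u v * v i)) i = 0" using that(1) by simp
      then show ?thesis using inj by (simp add: sum_fun_apply sum.reindex inj_on_subset)
    qed
    moreover have "(\<Sum>v\<in>B. u (j \<circ> v) * j (v i)) =
        (\<Sum>b\<in>\<beta>. b * j (\<Sum>v\<in>B. c (u (j \<circ> v)) b * v i))" for i
    proof -
      have "(\<Sum>v\<in>B. u (j \<circ> v) * j (v i)) =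
          (\<Sum>v\<in>B. (\<Sum>b\<in>\<beta>. b * j (c (u (j \<circ> v)) b)) * j (v i))"
        using c by (intro sum.cong arg_cong2[where f = times]) auto
      also have "\<dots> = (\<Sum>b\<in>\<beta>. b * j (\<Sum>v\<in>B. c (u (j \<circ> v)) b * v i))"
        unfolding j.hom_sum j.hom_mult sum_distrib_left sum_distrib_right
        by (subst sum.swap) (simp add: ac_simps)
      finally show ?thesis .
    qed
    ultimately have "(\<Sum>v\<in>B. c (u (j \<circ> v)) b * v i) = 0" if "b \<in> \<beta>" for b i
      using indep[of "\<lambda>b. \<Sum>v\<in>B. c (u (j \<circ> v)) b * v i"] that by simp
    then have "(\<Sum>v\<in>B. (\<lambda>i. c (u (j \<circ> v)) b * v i)) = 0" if "b \<in> \<beta>" for b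
      using that by (auto simp: fun_eq_iff sum_fun_apply)
    then have "c (u (j \<circ> a)) b = 0" if "b \<in> \<beta>" for b
      using V.independentD[OF B fin order_refl, of "\<lambda>v. c (u (j \<circ> v)) b"] that a by blast
    then show ?thesis using c[of "u (j \<circ> a)"] a by simp
  qed
  then show ?thesis
    unfolding W.dependent_finite[OF finite_imageI[OF fin]] by blast
qed

text \<open>
  If multiplication by an invertible matrix \<open>U\<close> over \<open>L\<close> maps one solution space over \<open>L\<close> into another,
  then the dimensions, and so the cardinalities, of the solution spaces over the finite field \<open>F\<close>
  satisfy the same inequality: a basis over \<open>F\<close> of the first stays independent over \<open>L\<close>, and a
  basis over \<open>F\<close> of the second spans over \<open>L\<close>.
\<close>

lemma card_intertwiners_le:
  fixes j :: "'f::field \<Rightarrow> 'l::field"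
  assumes j: "field_hom j" and F: "finite (UNIV :: 'f set)"
    and P: "P \<subseteq> carrier_mat n n \<times> carrier_mat n n"
    and P': "P' \<subseteq> carrier_mat n n \<times> carrier_mat n n"
    and K: "K \<subseteq> carrier_vec n"
    and U: "U \<in> carrier_mat n n" "U' \<in> carrier_mat n n" "U' * U = 1\<^sub>m n"
    and maps: "\<And>G. G \<in> intertwiners n (map_prod (map_mat j) (map_mat j) ` P) (map_vec j ` K) \<Longrightarrow>
      U * G \<in> intertwiners n (map_prod (map_mat j) (map_mat j) ` P') (map_vec j ` K)"
  shows "card (intertwiners n P K) \<le> card (intertwiners n P' K)"
proof -
  interpret j: field_hom j by fact
  let ?scF = "\<lambda>c (f :: nat \<times> nat \<Rightarrow> 'f) i. c * f i"
  let ?scL = "\<lambda>c (f :: nat \<times> nat \<Rightarrow> 'l) i. c * f i"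
  interpret V: vector_space ?scF by (rule vector_space_functions)
  interpret W: vector_space ?scL by (rule vector_space_functions)
  interpret WW: vector_space_pair ?scL ?scL by unfold_locales
  obtain B where B: "finite B" "V.independent B" "V.span B = entries n ` intertwiners n P K"
      "card (intertwiners n P K) = card (UNIV :: 'f set) ^ card B"
    by (rule intertwiners_basis[OF F P K])
  obtain B' where B': "finite B'" "V.independent B'" "V.span B' = entries n ` intertwiners n P' K"
      "card (intertwiners n P' K) = card (UNIV :: 'f set) ^ card B'"
    by (rule intertwiners_basis[OF F P' K])
  \<comment> \<open>Multiplication by \<open>U\<close>, in terms of entries.\<close>
  define \<Theta> where "\<Theta> g = entries n (U * mat n n g)" for g
  have \<Theta>: "\<Theta> g ik = (if ik \<in> {..<n} \<times> {..<n} then \<Sum>m<n. U $$ (fst ik, m) * g (m, snd ik) else 0)" for g ik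
    by (cases ik) (auto simp: \<Theta>_def entries_def index_mult_mat_sum[OF U(1), of "mat n n g"])
  have lin: "Vector_Spaces.linear ?scL ?scL \<Theta>"
    by unfold_locales
      (auto simp: fun_eq_iff \<Theta> algebra_simps sum.distrib sum_distrib_left)
  define S where "S = {g :: nat \<times> nat \<Rightarrow> 'l. \<forall>ik. ik \<notin> {..<n} \<times> {..<n} \<longrightarrow> g ik = 0}"
  have "W.subspace S" by (rule W.subspaceI) (auto simp: S_def)
  have BI: "\<exists>H \<in> intertwiners n P K. b = entries n H" if "b \<in> B" for b
    using V.span_base[OF that] B(3) by auto
  have "(\<circ>) j ` B \<subseteq> S"
    using BI by (fastforce simp: S_def entries_def)
  then have "W.span ((\<circ>) j ` B) \<subseteq> S"
    using \<open>W.subspace S\<close> by (rule W.span_minimal)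
  moreover have "inj_on \<Theta> S"
  proof (rule inj_onI)
    fix g h assume gh: "g \<in> S" "h \<in> S" "\<Theta> g = \<Theta> h"
    have UU: "mat n n g = U' * mat n n (\<Theta> g)" for g
    proof -
      have "mat n n (\<Theta> g) = U * mat n n g"
        unfolding \<Theta>_def by (rule mat_entries) (rule mult_carrier_mat[OF U(1)], simp)
      then have "U' * mat n n (\<Theta> g) = U' * U * mat n n g"
        by (simp only: assoc_mult_mat[OF U(2,1) mat_carrier])
      then show ?thesis by (simp add: U(3))
    qed
    have "mat n n g = mat n n h" unfolding UU[of g] UU[of h] gh(3) ..
    moreover have "entries n (mat n n f) = f" if "f \<in> S" for f :: "nat \<times> nat \<Rightarrow> 'l"
      using that unfolding S_def by (intro entries_mat) blast
    ultimately show "g = h" using gh(1,2) by metis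
  qed
  ultimately have inj: "inj_on \<Theta> (W.span ((\<circ>) j ` B))" by (rule inj_on_subset[rotated])
  have "W.independent ((\<circ>) j ` B)" by (rule independent_field_extension[OF j B(1,2)])
  from WW.linear_independent_injective_image[OF lin this inj]
  have ind: "W.independent (\<Theta> ` (\<circ>) j ` B)" .
  have "\<Theta> (j \<circ> b) \<in> W.span ((\<circ>) j ` B')" if b: "b \<in> B" for b
  proof -
    obtain H where H: "H \<in> intertwiners n P K" "b = entries n H" using BI[OF b] by blast
    have Hc: "H \<in> carrier_mat n n" using H(1) by (simp add: intertwiners_def)
    have "map_mat j H \<in> intertwiners n (map_prod (map_mat j) (map_mat j) ` P) (map_vec j ` K)"
      by (rule map_mat_intertwiners[OF j P K H(1)])
    then have "U * map_mat j H \<in>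
        intertwiners n (map_prod (map_mat j) (map_mat j) ` P') (map_vec j ` K)" by (rule maps)
    then obtain \<beta> H' where \<beta>: "finite \<beta>"
      and H': "\<And>b. b \<in> \<beta> \<Longrightarrow> H' b \<in> intertwiners n P' K"
      and eq: "\<And>i k. i < n \<Longrightarrow> k < n \<Longrightarrow>
        (U * map_mat j H) $$ (i, k) = (\<Sum>b\<in>\<beta>. b * j (H' b $$ (i, k)))"
      by (rule intertwiners_decompose[OF j P' K]) blast
    have "mat n n (j \<circ> b) = map_mat j H"
      using Hc by (intro eq_matI) (auto simp: H(2) entries_def)
    then have "\<Theta> (j \<circ> b) = (\<Sum>b\<in>\<beta>. ?scL b (j \<circ> entries n (H' b)))"
      using eq by (auto simp: \<Theta>_def entries_def fun_eq_iff sum_fun_apply)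
    also have "\<dots> \<in> W.span ((\<circ>) j ` B')"
    proof (intro W.span_sum W.span_scale)
      fix b assume "b \<in> \<beta>"
      then have "entries n (H' b) \<in> V.span B'" using H' B'(3) by blast
      then obtain u where "entries n (H' b) = (\<Sum>v\<in>B'. ?scF (u v) v)"
        unfolding V.span_finite[OF B'(1)] by auto
      then have "j \<circ> entries n (H' b) = (\<Sum>v\<in>B'. ?scL (j (u v)) (j \<circ> v))"
        by (auto simp: fun_eq_iff sum_fun_apply j.hom_sum j.hom_mult)
      also have "\<dots> \<in> W.span ((\<circ>) j ` B')"
        by (intro W.span_sum W.span_scale W.span_base imageI)
      finally show "j \<circ> entries n (H' b) \<in> W.span ((\<circ>) j ` B')" .
    qed
    finally show ?thesis .
  qed
  then have "\<Theta> ` (\<circ>) j ` B \<subseteq> W.span ((\<circ>) j ` B')" by auto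
  from W.independent_span_bound[OF finite_imageI[OF B'(1)] ind this]
  have "card (\<Theta> ` (\<circ>) j ` B) \<le> card ((\<circ>) j ` B')" by simp
  also have "\<dots> \<le> card B'" using B'(1) by (rule card_image_le)
  also have "card (\<Theta> ` (\<circ>) j ` B) = card B"
  proof -
    have "inj_on ((\<circ>) j) B" by (auto simp: inj_on_def fun_eq_iff)
    moreover have "inj_on \<Theta> ((\<circ>) j ` B)" using inj W.span_superset by (rule inj_on_subset)
    ultimately show ?thesis by (simp add: card_image)
  qed
  finally have "card B \<le> card B'" .
  moreover have "0 < card (UNIV :: 'f set)" using F by (simp add: card_gt_0_iff)
  ultimately show ?thesis by (simp add: B(4) B'(4) power_increasing)
qed

lemma finite_carrier_vec:
  assumes "finite (UNIV :: 'f set)"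
  shows "finite (carrier_vec n :: 'f vec set)"
proof -
  have "finite (vec n ` (({..<n}) \<rightarrow>\<^sub>E (UNIV :: 'f set)))"
    using assms by (intro finite_imageI finite_PiE) auto
  moreover have "carrier_vec n \<subseteq> vec n ` (({..<n}) \<rightarrow>\<^sub>E (UNIV :: 'f set))"
  proof
    fix v :: "'f vec" assume "v \<in> carrier_vec n"
    then have "v = vec n (restrict (($) v) {..<n})" by (intro eq_vecI) auto
    then show "v \<in> vec n ` (({..<n}) \<rightarrow>\<^sub>E (UNIV :: 'f set))"
      by (rule image_eqI[where x = "restrict (($) v) {..<n}"]) auto
  qed
  ultimately show ?thesis by (rule rev_finite_subset)
qed

lemma noether_deuring_finite:
  fixes j :: "'f::field \<Rightarrow> 'l::field"
  assumes j: "field_hom j" and F: "finite (UNIV :: 'f set)"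
    and P: "P \<subseteq> carrier_mat n n \<times> carrier_mat n n"
    and G: "G \<in> intertwiners n (map_prod (map_mat j) (map_mat j) ` P) {}" "det G \<noteq> 0"
  shows "\<exists>H \<in> intertwiners n P {}. det H \<noteq> 0"
proof -
  interpret j: field_hom j by fact
  have Gc: "G \<in> carrier_mat n n" using G(1) by (simp add: intertwiners_def)
  have GXY: "map_mat j X * G = G * map_mat j Y" if "(X, Y) \<in> P" for X Y
    using G(1) that by (force simp: intertwiners_def)
  obtain G' where G': "G' \<in> carrier_mat n n" "G' * G = 1\<^sub>m n" "G * G' = 1\<^sub>m n"
    using det_non_zero_imp_unit[OF Gc G(2), of "()"]
    by (auto simp: Units_def ring_mat_def)
  \<comment> \<open>With respect to \<open>P'\<close>, intertwining matrices are the endomorphisms of \<open>F\<^sup>n\<close> with the operators \<open>Y\<close>.\<close>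
  define P' where "P' = (\<lambda>(X, Y). (Y, Y)) ` P"
  have P': "P' \<subseteq> carrier_mat n n \<times> carrier_mat n n" using P by (auto simp: P'_def)
  let ?ker = "\<lambda>H :: 'f mat. {v \<in> carrier_vec n. H *\<^sub>v v = 0\<^sub>v n}"
  let ?j = "(`) (map_prod (map_mat j) (map_mat j))"
  have fin: "finite (carrier_vec n :: 'f vec set)" by (rule finite_carrier_vec[OF F])
  have card: "card (intertwiners n P' K) = card (intertwiners n P K)" if K: "K \<subseteq> carrier_vec n" for K
  proof (rule antisym)
    show "card (intertwiners n P' K) \<le> card (intertwiners n P K)"
    proof (rule card_intertwiners_le[OF j F P' P K Gc G'(1,2)])
      fix E assume E: "E \<in> intertwiners n (?j P') (map_vec j ` K)"
      then have Ec: "E \<in> carrier_mat n n"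
        and EY: "\<And>X Y. (X, Y) \<in> P \<Longrightarrow> map_mat j Y * E = E * map_mat j Y"
        and EK: "\<And>k. k \<in> K \<Longrightarrow> E *\<^sub>v map_vec j k = 0\<^sub>v n"
        by (force simp: intertwiners_def P'_def)+
      show "G * E \<in> intertwiners n (?j P) (map_vec j ` K)"
        unfolding intertwiners_def
      proof safe
        show "G * E \<in> carrier_mat n n" using Gc Ec by simp
      next
        fix X Y assume XY: "(X, Y) \<in> P"
        then have c: "map_mat j X \<in> carrier_mat n n" "map_mat j Y \<in> carrier_mat n n"
          using P by auto
        have "map_mat j X * (G * E) = G * map_mat j Y * E"
          using assoc_mult_mat[OF c(1) Gc Ec] GXY[OF XY] by simp
        also have "\<dots> = G * (map_mat j Y * E)" by (rule assoc_mult_mat[OF Gc c(2) Ec])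
        also have "\<dots> = G * (E * map_mat j Y)" using EY[OF XY] by simp
        also have "\<dots> = G * E * map_mat j Y" by (rule assoc_mult_mat[OF Gc Ec c(2), symmetric])
        finally show "map_mat j X * (G * E) = G * E * map_mat j Y" .
      next
        fix k assume k: "k \<in> K"
        then have "map_vec j k \<in> carrier_vec n" using K by auto
        then have "(G * E) *\<^sub>v map_vec j k = G *\<^sub>v (E *\<^sub>v map_vec j k)"
          by (rule assoc_mult_mat_vec[OF Gc Ec])
        then show "(G * E) *\<^sub>v map_vec j k = 0\<^sub>v n" using EK[OF k] Gc by auto
      qed
    qed
    show "card (intertwiners n P K) \<le> card (intertwiners n P' K)"
    proof (rule card_intertwiners_le[OF j F P P' K G'(1) Gc G'(3)])
      fix E assume E: "E \<in> intertwiners n (?j P) (map_vec j ` K)"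
      then have Ec: "E \<in> carrier_mat n n"
        and EY: "\<And>X Y. (X, Y) \<in> P \<Longrightarrow> map_mat j X * E = E * map_mat j Y"
        and EK: "\<And>k. k \<in> K \<Longrightarrow> E *\<^sub>v map_vec j k = 0\<^sub>v n"
        by (force simp: intertwiners_def)+
      show "G' * E \<in> intertwiners n (?j P') (map_vec j ` K)"
        unfolding intertwiners_def P'_def
      proof safe
        show "G' * E \<in> carrier_mat n n" using G' Ec by simp
      next
        fix X Y assume XY: "(X, Y) \<in> P"
        then have c: "map_mat j X \<in> carrier_mat n n" "map_mat j Y \<in> carrier_mat n n"
          using P by auto
        have "map_mat j Y * G' = G' * G * map_mat j Y * G'" using c G' by simp
        also have "\<dots> = G' * (G * map_mat j Y) * G'"
          using assoc_mult_mat[OF G'(1) Gc c(2)] by simp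
        also have "\<dots> = G' * (map_mat j X * G) * G'" using GXY[OF XY] by simp
        also have "\<dots> = G' * map_mat j X * G * G'"
          using assoc_mult_mat[OF G'(1) c(1) Gc] by simp
        also have "\<dots> = G' * map_mat j X * (G * G')"
          using c Gc G'(1) by (intro assoc_mult_mat[of _ n n _ n _ n]) auto
        also have "\<dots> = G' * map_mat j X" using c G' by simp
        finally have *: "map_mat j Y * G' = G' * map_mat j X" .
        have "map_mat j Y * (G' * E) = G' * map_mat j X * E"
          using assoc_mult_mat[OF c(2) G'(1) Ec] * by simp
        also have "\<dots> = G' * (map_mat j X * E)" by (rule assoc_mult_mat[OF G'(1) c(1) Ec])
        also have "\<dots> = G' * (E * map_mat j Y)" using EY[OF XY] by simp
        also have "\<dots> = G' * E * map_mat j Y" by (rule assoc_mult_mat[OF G'(1) Ec c(2), symmetric])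
        finally show "map_mat j Y * (G' * E) = G' * E * map_mat j Y" .
      next
        fix k assume k: "k \<in> K"
        then have "map_vec j k \<in> carrier_vec n" using K by auto
        then have "(G' * E) *\<^sub>v map_vec j k = G' *\<^sub>v (E *\<^sub>v map_vec j k)"
          by (rule assoc_mult_mat_vec[OF G'(1) Ec])
        then show "(G' * E) *\<^sub>v map_vec j k = 0\<^sub>v n" using EK[OF k] G'(1) by auto
      qed
    qed
  qed
  have finI: "finite (intertwiners n Q {})" if "Q \<subseteq> carrier_mat n n \<times> carrier_mat n n"
    for Q :: "('f mat \<times> 'f mat) set"
    by (rule intertwiners_basis[OF F that, of "{}"])
      (use F in \<open>auto simp: card_gt_0_iff intro: card_ge_0_finite\<close>)
  have killing: "{H \<in> intertwiners n Q {}. K \<subseteq> ?ker H} = intertwiners n Q K"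
    if "K \<subseteq> carrier_vec n" for K and Q :: "('f mat \<times> 'f mat) set"
    using that by (auto simp: intertwiners_def)
  \<comment> \<open>Endomorphisms and intertwining matrices with kernel \<open>0\<close> are equally many.\<close>
  have "card {H \<in> intertwiners n P' {}. ?ker H = {0\<^sub>v n}} =
      card {H \<in> intertwiners n P {}. ?ker H = {0\<^sub>v n}}"
    by (rule intertwiner_counting[OF finI[OF P'] finI[OF P] fin])
      (auto simp: killing card)
  moreover have "1\<^sub>m n \<in> {H \<in> intertwiners n P' {}. ?ker H = {0\<^sub>v n}}"
    using P by (auto simp: intertwiners_def P'_def)
  then have "card {H \<in> intertwiners n P' {}. ?ker H = {0\<^sub>v n}} \<noteq> 0"
    using finI[OF P'] by (auto simp: card_eq_0_iff)
  ultimately have "{H \<in> intertwiners n P {}. ?ker H = {0\<^sub>v n}} \<noteq> {}"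
    by (metis card.empty)
  then obtain H where H: "H \<in> intertwiners n P {}" "?ker H = {0\<^sub>v n}" by blast
  have "H \<in> carrier_mat n n" using H(1) by (simp add: intertwiners_def)
  then have "det H \<noteq> 0" using H(2) by (auto simp: det_0_iff_vec_prod_zero)
  with H(1) show ?thesis by blast
qed

section \<open>Descent of intertwining matrices\<close>

text \<open>
  The Noether--Deuring theorem in terms of matrices: two families of matrices over a field that are
  conjugate by one invertible matrix over an extension field are so over the field itself.
\<close>

lemma noether_deuring:
  fixes j :: "'f::field \<Rightarrow> 'l::field"
  assumes j: "field_hom j" and P: "P \<subseteq> carrier_mat n n \<times> carrier_mat n n"
  shows "(\<exists>G\<in>intertwiners n (map_prod (map_mat j) (map_mat j) ` P) {}. det G \<noteq> 0) \<longleftrightarrow>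
    (\<exists>H\<in>intertwiners n P {}. det H \<noteq> 0)"
proof
  assume "\<exists>G\<in>intertwiners n (map_prod (map_mat j) (map_mat j) ` P) {}. det G \<noteq> 0"
  then show "\<exists>H\<in>intertwiners n P {}. det H \<noteq> 0"
    using noether_deuring_finite[OF j _ P] noether_deuring_infinite[OF j _ P] by blast
next
  interpret j: field_hom j by fact
  assume "\<exists>H\<in>intertwiners n P {}. det H \<noteq> 0"
  then obtain H where H: "H \<in> intertwiners n P {}" "det H \<noteq> 0" by blast
  then have "map_mat j H \<in> intertwiners n (map_prod (map_mat j) (map_mat j) ` P) (map_vec j ` {})"
    using P by (intro map_mat_intertwiners[OF j]) auto
  moreover have "det (map_mat j H) \<noteq> 0" using H(2) by simp
  ultimately show "\<exists>G\<in>intertwiners n (map_prod (map_mat j) (map_mat j) ` P) {}. det G \<noteq> 0"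
    unfolding image_empty by blast
qed

section \<open>Coordinates on a finitely generated module\<close>

text \<open>
  Elements \<open>v 0, \<dots>, v (n - 1)\<close> of a module over a domain that form a basis after passing to the
  fraction field. All coordinates have the common denominator \<open>d\<close>: the \<open>i\<close>-th coordinate of \<open>x\<close>
  is \<open>a x i / d\<close>.
\<close>

locale rational_basis = Modules.module s
  for s :: "'r::idom \<Rightarrow> 'm::ab_group_add \<Rightarrow> 'm" +
  fixes n :: nat and v :: "nat \<Rightarrow> 'm" and a :: "'m \<Rightarrow> nat \<Rightarrow> 'r" and d :: 'r
  assumes d: "d \<noteq> 0"
    and expansion: "s d x = (\<Sum>i<n. s (a x i) (v i))"
    and a_add: "a (x + y) i = a x i + a y i"
    and a_scale: "a (s r x) i = r * a x i"
    and a_basis: "i < n \<Longrightarrow> k < n \<Longrightarrow> a (v k) i = (if i = k then d else 0)"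

lemma rational_basis_exists:
  fixes s :: "'r::idom \<Rightarrow> 'm::ab_group_add \<Rightarrow> 'm"
  assumes "Modules.module s" and F: "finite F" and gen: "\<And>x. \<exists>c. x = (\<Sum>y\<in>F. s (c y) y)"
  shows "\<exists>n v a d. rational_basis s n v a d"
proof -
  interpret Modules.module s by fact
  \<comment> \<open>A maximal independent subset of the generators.\<close>
  let ?I = "{B. B \<subseteq> F \<and> independent B}"
  have "finite ?I" using F by simp
  moreover have "?I \<noteq> {}" using independent_empty by blast
  ultimately have "\<exists>B\<in>?I. \<forall>B'\<in>?I. B \<subseteq> B' \<longrightarrow> B = B'"
    by (rule finite_has_maximal)
  then obtain B where B: "B \<subseteq> F" "independent B"
    and max: "\<And>B'. B' \<subseteq> F \<Longrightarrow> independent B' \<Longrightarrow> B \<subseteq> B' \<Longrightarrow> B = B'"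
    by auto
  have finB: "finite B" using B(1) F finite_subset by blast
  have "\<exists>r. r \<noteq> 0 \<and> s r y \<in> span B" if y: "y \<in> F" for y
  proof (cases "y \<in> B")
    case True
    then show ?thesis by (intro exI[of _ 1]) (auto intro: span_base)
  next
    case False
    then have "dependent (insert y B)" using max[of "insert y B"] y B(1) by blast
    then obtain u x where x: "x \<in> insert y B" "u x \<noteq> 0"
      and u: "(\<Sum>x\<in>insert y B. s (u x) x) = 0"
      using finB by (auto simp: dependent_finite)
    then have eq: "s (u y) y + (\<Sum>x\<in>B. s (u x) x) = 0"
      using False finB by simp
    have "u y \<noteq> 0"
    proof
      assume "u y = 0"
      with eq have "(\<Sum>x\<in>B. s (u x) x) = 0" by simp
      from independentD[OF B(2) finB order_refl this] x \<open>u y = 0\<close> show False by auto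
    qed
    moreover have "s (u y) y = - (\<Sum>x\<in>B. s (u x) x)" using eq by (simp add: eq_neg_iff_add_eq_0)
    moreover have "- (\<Sum>x\<in>B. s (u x) x) \<in> span B"
      by (intro span_neg span_sum span_scale span_base)
    ultimately show ?thesis by (intro exI[of _ "u y"]) simp
  qed
  then obtain r where r: "\<And>y. y \<in> F \<Longrightarrow> r y \<noteq> 0 \<and> s (r y) y \<in> span B" by metis
  define d where "d = prod r F"
  have d: "d \<noteq> 0" using r F by (simp add: d_def)
  have gen_span: "s d y \<in> span B" if y: "y \<in> F" for y
  proof -
    have "d = prod r (F - {y}) * r y" using F y by (simp add: d_def prod.remove mult.commute)
    then have "s d y = s (prod r (F - {y})) (s (r y) y)" by simp
    then show ?thesis using r[OF y] by (metis span_scale)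
  qed
  have in_span: "s d x \<in> span B" for x
  proof -
    obtain c where "x = (\<Sum>y\<in>F. s (c y) y)" using gen by blast
    then have "s d x = (\<Sum>y\<in>F. s (c y) (s d y))"
      by (simp add: scale_sum_right mult.commute)
    also have "\<dots> \<in> span B" by (intro span_sum span_scale gen_span)
    finally show ?thesis .
  qed
  obtain v where v: "bij_betw v {0..<card B} B" using ex_bij_betw_nat_finite[OF finB] by blast
  have v': "bij_betw v {..<card B} B" using v by (simp add: atLeast0LessThan)
  have "rational_basis s (card B) v (\<lambda>x i. representation B (s d x) (v i)) d"
  proof unfold_locales
    show "d \<noteq> 0" by fact
    fix x y :: 'm and q :: 'r and i k :: nat
    show "s d x = (\<Sum>i<card B. s (representation B (s d x) (v i)) (v i))"
      using sum_representation_eq[OF B(2) in_span finB order_refl, of x]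
        sum.reindex_bij_betw[OF v', of "\<lambda>b. s (representation B (s d x) b) b"] by simp
    show "representation B (s d (x + y)) (v i) =
        representation B (s d x) (v i) + representation B (s d y) (v i)"
      by (simp add: scale_right_distrib representation_add[OF B(2) in_span in_span])
    show "representation B (s d (s q x)) (v i) = q * representation B (s d x) (v i)"
    proof -
      have "s d (s q x) = s q (s d x)" by (simp add: mult.commute)
      then show ?thesis by (simp only: representation_scale[OF B(2) in_span])
    qed
    assume ik: "i < card B" "k < card B"
    then have "v k \<in> B" using v' by (auto simp: bij_betw_def)
    moreover have "v i = v k \<longleftrightarrow> i = k" using v' ik by (auto simp: bij_betw_def inj_on_def)
    ultimately show "representation B (s d (v k)) (v i) = (if i = k then d else 0)"
      by (simp add: representation_scale[OF B(2)] span_base representation_basis[OF B(2)])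
  qed
  then show ?thesis by blast
qed

section \<open>Pairings and the base change\<close>

lemma bilinear_pairing_iff:
  fixes e :: "'r::comm_ring_1 \<Rightarrow> 'l::field"
  assumes "Modules.module s" and e: "comm_ring_hom e"
  shows "bilinear_pairing e s B \<longleftrightarrow>
    (\<forall>x y z. B (x + y) z = B x z + B y z) \<and> (\<forall>x y z. B x (y + z) = B x y + B x z) \<and>
    (\<forall>r x y. B (s r x) y = e r * B x y) \<and> (\<forall>r x y. B x (s r y) = e r * B x y)"
proof -
  interpret e: comm_ring_hom e by fact
  have "Modules.module (algebra_scale e)"
    by unfold_locales (simp_all add: algebra_scale_def algebra_simps e.hom_add e.hom_mult)
  then show ?thesis
    using assms(1)
    by (auto simp: bilinear_pairing_def module_hom_iff algebra_scale_def)
qed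

lemma module_poly_mapping: "Modules.module (\<lambda>l. Poly_Mapping.map ((*) l) :: ('i \<Rightarrow>\<^sub>0 'l::field) \<Rightarrow> _)"
  by (unfold_locales; intro poly_mapping_eqI)
    (auto simp: lookup_map_times lookup_add algebra_simps)

lemma single_sum: "Poly_Mapping.single x (sum f I) = (\<Sum>i\<in>I. Poly_Mapping.single x (f i))"
  by (induction I rule: infinite_finite_induct) (simp_all add: single_add)

lemma extend_pairing_single_left:
  "extend_pairing B (Poly_Mapping.single x l) g =
    l * (\<Sum>y\<in>Poly_Mapping.keys g. Poly_Mapping.lookup g y * B x y)"
  by (subst extend_pairing_superset[of "{x}"]) auto

lemma extend_pairing_sum_left:
  "extend_pairing B (\<Sum>i\<in>I. f i) g = (\<Sum>i\<in>I. extend_pairing B (f i) g)"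
  by (induction I rule: infinite_finite_induct)
    (simp_all add: extend_pairing_add, simp_all add: extend_pairing_def)

lemma extend_pairing_single_right:
  "extend_pairing B f (Poly_Mapping.single y l) =
    l * (\<Sum>x\<in>Poly_Mapping.keys f. Poly_Mapping.lookup f x * B x y)"
  by (subst extend_pairing_swap) (simp add: extend_pairing_single_left)

section \<open>Components of a direct sum decomposition\<close>

text \<open>
  The component of \<open>x\<close> in the summand \<open>M c\<close>; meaningful if \<open>M\<close> is a direct sum decomposition.
\<close>

definition component :: "('c::finite \<Rightarrow> 'm::comm_monoid_add set) \<Rightarrow> 'c \<Rightarrow> 'm \<Rightarrow> 'm"
  where "component M c x = (THE f. (\<forall>c. f c \<in> M c) \<and> x = (\<Sum>c\<in>UNIV. f c)) c"

lemma
  assumes "direct_sum_decomposition M"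
  shows component_in: "component M c x \<in> M c"
    and sum_component: "(\<Sum>c\<in>UNIV. component M c x) = x"
    and component_unique: "(\<And>c. f c \<in> M c) \<Longrightarrow> x = (\<Sum>c\<in>UNIV. f c) \<Longrightarrow> component M c x = f c"
proof -
  have ex1: "\<exists>!f. (\<forall>c. f c \<in> M c) \<and> x = (\<Sum>c\<in>UNIV. f c)"
    using assms by (simp add: direct_sum_decomposition_def)
  from theI'[OF ex1] show "component M c x \<in> M c" "(\<Sum>c\<in>UNIV. component M c x) = x"
    by (simp_all add: component_def)
  assume "\<And>c. f c \<in> M c" "x = (\<Sum>c\<in>UNIV. f c)"
  then show "component M c x = f c"
    unfolding component_def using the1_equality[OF ex1, of f] by simp
qed

context Modules.module
begin

lemma component_linear:
  assumes M: "\<And>c. subspace (M c)" "direct_sum_decomposition M"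
  shows "module_hom scale scale (component M c)"
proof -
  note comp = component_in[OF M(2)] sum_component[OF M(2)]
  have "component M c (x + y) = component M c x + component M c y" for x y
    by (rule component_unique[OF M(2), where f = "\<lambda>c. component M c x + component M c y"])
      (simp_all add: sum.distrib comp subspace_add[OF M(1)])
  moreover have "component M c (scale r x) = scale r (component M c x)" for r x
    by (rule component_unique[OF M(2), where f = "\<lambda>c. scale r (component M c x)"])
      (simp_all add: comp subspace_scale[OF M(1)] flip: scale_sum_right)
  ultimately show ?thesis by (simp add: module_hom_iff module_axioms)
qed

lemma component_component:
  assumes M: "\<And>c. subspace (M c)" "direct_sum_decomposition M" and x: "x \<in> M c"
  shows "component M c' x = (if c' = c then x else 0)"
  by (rule component_unique[OF M(2), where f = "\<lambda>c'. if c' = c then x else 0"])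
    (use x subspace_0[OF M(1)] in simp_all)

end

section \<open>Gram matrices\<close>

context rational_basis
begin

text \<open>
  The \<open>i\<close>-th coordinate of \<open>x\<close>, in the fraction field.
\<close>

definition coord :: "'m \<Rightarrow> nat \<Rightarrow> 'r fract"
  where "coord x i = Fract (a x i) d"

text \<open>
  The matrix of an endomorphism of the module; the images of the basis are the columns.
\<close>

definition endo_matrix :: "('m \<Rightarrow> 'm) \<Rightarrow> 'r fract mat"
  where "endo_matrix g = mat n n (\<lambda>(i, k). coord (g (v k)) i)"

text \<open>
  The values of a pairing on the basis.
\<close>

definition gram_matrix :: "('m \<Rightarrow> 'm \<Rightarrow> 'l) \<Rightarrow> 'l mat"
  where "gram_matrix B = mat n n (\<lambda>(i, k). B (v i) (v k))"

lemma endo_matrix_carrier [simp]: "endo_matrix g \<in> carrier_mat n n"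
  by (simp add: endo_matrix_def)

lemma gram_matrix_carrier [simp]: "gram_matrix B \<in> carrier_mat n n"
  by (simp add: gram_matrix_def)

lemma coord_add: "coord (x + y) i = coord x i + coord y i"
  using d by (simp add: coord_def a_add eq_fract algebra_simps)

lemma coord_scale: "coord (s r x) i = Fract r 1 * coord x i"
  using d by (simp add: coord_def a_scale)

lemma coord_basis: "i < n \<Longrightarrow> k < n \<Longrightarrow> coord (v k) i = (if i = k then 1 else 0)"
  using d by (simp add: coord_def a_basis eq_fract One_fract_def Zero_fract_def)

end

text \<open>
  In addition, an embedding \<open>j\<close> of the fraction field into a field \<open>L\<close>, in which pairings take values.
\<close>

locale rational_basis_embedding = rational_basis s n v a d + j: field_hom j
  for s :: "'r::idom \<Rightarrow> 'm::ab_group_add \<Rightarrow> 'm" and n v a d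
    and j :: "'r fract \<Rightarrow> 'l::field"
begin

abbreviation e :: "'r \<Rightarrow> 'l" where "e r \<equiv> j (Fract r 1)"

lemma e_hom: "comm_ring_hom e"
proof unfold_locales
  fix x y :: 'r
  have "Fract (x + y) 1 = Fract x 1 + Fract y 1" by simp
  then show "e (x + y) = e x + e y" by (simp only: j.hom_add)
  have "Fract (x * y) 1 = Fract x 1 * Fract y 1" by simp
  then show "e (x * y) = e x * e y" by (simp only: j.hom_mult)
qed (simp_all flip: One_fract_def Zero_fract_def)

lemma e_d: "e d \<noteq> 0"
  using d by (simp add: Zero_fract_def eq_fract)

lemma e_numerator: "e (a x i) = e d * j (coord x i)"
proof -
  have "Fract (a x i) 1 = Fract d 1 * coord x i"
    using d by (simp add: coord_def eq_fract)
  then show ?thesis by (simp only: j.hom_mult)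
qed

text \<open>
  A linear map into \<open>L\<close> is determined by its values on the basis, since \<open>d\<close> is invertible in \<open>L\<close>.
\<close>

lemma linear_expansion:
  fixes h :: "'m \<Rightarrow> 'l"
  assumes add: "\<And>x y. h (x + y) = h x + h y" and scale: "\<And>r x. h (s r x) = e r * h x"
  shows "h x = (\<Sum>i<n. j (coord x i) * h (v i))"
proof -
  have h0: "h 0 = 0" using add[of 0 0] by (metis add.right_neutral add_left_cancel)
  have sum: "h (sum f I) = (\<Sum>i\<in>I. h (f i))" for f :: "nat \<Rightarrow> 'm" and I
    by (induction I rule: infinite_finite_induct) (simp_all add: add h0)
  have "e d * h x = h (s d x)" by (simp add: scale)
  also have "\<dots> = (\<Sum>i<n. e (a x i) * h (v i))" by (simp add: expansion[of x] sum scale)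
  also have "\<dots> = e d * (\<Sum>i<n. j (coord x i) * h (v i))"
    by (simp add: e_numerator sum_distrib_left mult.assoc)
  finally show ?thesis using e_d by simp
qed

lemma bilinear_expansion:
  assumes "bilinear_pairing e s B"
  shows "B x y = (\<Sum>i<n. \<Sum>k<n. j (coord x i) * j (coord y k) * B (v i) (v k))"
proof -
  note B = assms[unfolded bilinear_pairing_iff[OF module_axioms e_hom]]
  have "B x y = (\<Sum>i<n. j (coord x i) * B (v i) y)"
    by (rule linear_expansion[of "\<lambda>x. B x y"]) (use B in auto)
  also have "\<dots> = (\<Sum>i<n. j (coord x i) * (\<Sum>k<n. j (coord y k) * B (v i) (v k)))"
    by (intro sum.cong refl arg_cong2[where f = times] linear_expansion[of "B (v _)"])
      (use B in auto)
  finally show ?thesis by (simp add: sum_distrib_left mult.assoc)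
qed

lemma bilinear_pairing_eqI:
  assumes "bilinear_pairing e s B" "bilinear_pairing e s B'"
    and "\<And>i k. i < n \<Longrightarrow> k < n \<Longrightarrow> B (v i) (v k) = B' (v i) (v k)"
  shows "B x y = B' x y"
  using bilinear_expansion[OF assms(1), of x y] bilinear_expansion[OF assms(2), of x y] assms(3)
  by simp

text \<open>
  The bilinear pairing with Gram matrix \<open>G\<close>.
\<close>

definition pairing_of :: "'l mat \<Rightarrow> 'm \<Rightarrow> 'm \<Rightarrow> 'l"
  where "pairing_of G x y = (\<Sum>i<n. \<Sum>k<n. j (coord x i) * j (coord y k) * G $$ (i, k))"

lemma bilinear_pairing_of: "bilinear_pairing e s (pairing_of G)"
  unfolding bilinear_pairing_iff[OF module_axioms e_hom] pairing_of_def
  by (simp add: coord_add coord_scale j.hom_add j.hom_mult algebra_simps sum.distrib sum_distrib_left)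

lemma gram_matrix_pairing_of:
  assumes "G \<in> carrier_mat n n"
  shows "gram_matrix (pairing_of G) = G"
proof (rule eq_matI)
  fix p q assume "p < dim_row G" "q < dim_col G"
  then have pq: "p < n" "q < n" using assms by auto
  have "pairing_of G (v p) (v q) =
      (\<Sum>i<n. \<Sum>k<n. if k = q then (if i = p then G $$ (i, k) else 0) else 0)"
    unfolding pairing_of_def using pq by (intro sum.cong) (auto simp: coord_basis)
  also have "\<dots> = G $$ (p, q)" using pq by simp
  finally show "gram_matrix (pairing_of G) $$ (p, q) = G $$ (p, q)"
    using pq by (simp add: gram_matrix_def)
qed (use assms in \<open>auto simp: gram_matrix_def\<close>)

lemma adjoint_iff:
  assumes B: "bilinear_pairing e s B" and g: "module_hom s s g" and h: "module_hom s s h"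
  shows "(\<forall>x y. B (g x) y = B x (h y)) \<longleftrightarrow>
    map_mat j (transpose_mat (endo_matrix g)) * gram_matrix B =
    gram_matrix B * map_mat j (endo_matrix h)" (is "_ \<longleftrightarrow> ?L = ?R")
proof -
  note Bi = B[unfolded bilinear_pairing_iff[OF module_axioms e_hom]]
  interpret g: module_hom s s g by fact
  interpret h: module_hom s s h by fact
  have Bg: "bilinear_pairing e s (\<lambda>x y. B (g x) y)" and Bh: "bilinear_pairing e s (\<lambda>x y. B x (h y))"
    unfolding bilinear_pairing_iff[OF module_axioms e_hom]
    using Bi by (simp_all add: g.add g.scale h.add h.scale)
  have L: "?L $$ (p, q) = B (g (v p)) (v q)" if pq: "p < n" "q < n" for p q
  proof -
    have "B (g (v p)) (v q) = (\<Sum>i<n. j (coord (g (v p)) i) * B (v i) (v q))"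
      by (rule linear_expansion[of "\<lambda>x. B x (v q)"]) (use Bi in auto)
    also have "\<dots> = ?L $$ (p, q)"
      using pq by (subst index_mult_mat_sum[of _ n]) (auto simp: endo_matrix_def gram_matrix_def)
    finally show ?thesis ..
  qed
  have R: "?R $$ (p, q) = B (v p) (h (v q))" if pq: "p < n" "q < n" for p q
  proof -
    have "B (v p) (h (v q)) = (\<Sum>i<n. j (coord (h (v q)) i) * B (v p) (v i))"
      by (rule linear_expansion[of "B (v p)"]) (use Bi in auto)
    also have "\<dots> = ?R $$ (p, q)"
      using pq by (subst index_mult_mat_sum[of _ n])
        (auto simp: endo_matrix_def gram_matrix_def mult.commute)
    finally show ?thesis ..
  qed
  show ?thesis
  proof
    assume *: "\<forall>x y. B (g x) y = B x (h y)"
    show "?L = ?R"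
      by (rule eq_matI) (use * L R in \<open>auto simp: gram_matrix_def endo_matrix_def\<close>)
  next
    assume "?L = ?R"
    then have "B (g (v p)) (v q) = B (v p) (h (v q))" if "p < n" "q < n" for p q
      using L R that by metis
    then show "\<forall>x y. B (g x) y = B x (h y)"
      using bilinear_pairing_eqI[OF Bg Bh] by blast
  qed
qed

text \<open>
  The classes of the \<open>v i\<close> form a basis of \<open>L \<otimes>\<^sub>R M\<close>: they span it by \<open>null_expand\<close>, and they are
  independent because the coordinate functions vanish on \<open>tensor_null\<close>.
\<close>

lemma left_nondegenerate_iff:
  assumes B: "bilinear_pairing e s B"
  shows "(\<forall>f. (\<forall>g. extend_pairing B f g = 0) \<longrightarrow> f \<in> tensor_null e s) \<longleftrightarrow>
    det (gram_matrix B) \<noteq> 0"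
proof -
  note Bi = B[unfolded bilinear_pairing_iff[OF module_axioms e_hom]]
  let ?S = "Poly_Mapping.single :: 'm \<Rightarrow> 'l \<Rightarrow> _" and ?G = "transpose_mat (gram_matrix B)"
  have det: "det (gram_matrix B) = det ?G" by (rule det_transpose[OF gram_matrix_carrier, symmetric])
  have G: "?G \<in> carrier_mat n n" by simp
  have Gv: "(?G *\<^sub>v c) $ k = (\<Sum>i<n. c $ i * B (v i) (v k))" if "c \<in> carrier_vec n" "k < n" for c k
    using that by (subst index_mult_mat_vec_sum[OF G]) (auto simp: gram_matrix_def mult.commute)
  have Bv: "B x y = (\<Sum>k<n. j (coord y k) * B x (v k))" for x y
    by (rule linear_expansion[of "B x"]) (use Bi in auto)
  show ?thesis
  proof
    assume nondeg: "\<forall>f. (\<forall>g. extend_pairing B f g = 0) \<longrightarrow> f \<in> tensor_null e s"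
    show "det (gram_matrix B) \<noteq> 0"
    proof
      assume "det (gram_matrix B) = 0"
      then obtain c where c: "c \<in> carrier_vec n" "c \<noteq> 0\<^sub>v n" "?G *\<^sub>v c = 0\<^sub>v n"
        unfolding det det_0_iff_vec_prod_zero[OF G] by blast
      let ?f = "\<Sum>i<n. ?S (v i) (c $ i)"
      have row: "(\<Sum>i<n. c $ i * B (v i) (v k)) = 0" if "k < n" for k
        using Gv[OF c(1) that] c(3) that by simp
      have orth: "(\<Sum>i<n. c $ i * B (v i) y) = 0" for y
      proof -
        have "(\<Sum>i<n. c $ i * B (v i) y) =
            (\<Sum>k<n. j (coord y k) * (\<Sum>i<n. c $ i * B (v i) (v k)))"
          by (subst Bv, simp only: sum_distrib_left, subst sum.swap) (simp add: ac_simps)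
        also have "\<dots> = 0" using row by (intro sum.neutral) auto
        finally show ?thesis .
      qed
      have "extend_pairing B ?f g = 0" for g
      proof -
        have "extend_pairing B ?f g = (\<Sum>y\<in>Poly_Mapping.keys g. Poly_Mapping.lookup g y *
            (\<Sum>i<n. c $ i * B (v i) y))"
          by (simp only: extend_pairing_sum_left extend_pairing_single_left sum_distrib_left,
              subst sum.swap) (simp add: ac_simps)
        also have "\<dots> = 0" by (simp add: orth)
        finally show ?thesis .
      qed
      with nondeg have null: "?f \<in> tensor_null e s" by blast
      have "c $ k = 0" if k: "k < n" for k
      proof -
        \<comment> \<open>The \<open>k\<close>-th coordinate of \<open>?f\<close> is its value under the pairing \<open>?D\<close> with \<open>v k\<close>.\<close>
        let ?D = "\<lambda>x y. j (coord x k) * j (coord y k)"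
        have "bilinear_pairing e s ?D"
          unfolding bilinear_pairing_iff[OF module_axioms e_hom]
          by (simp add: coord_add coord_scale j.hom_add j.hom_mult algebra_simps)
        from extend_pairing_null_left[OF this null, of "?S (v k) 1"]
        have "0 = (\<Sum>i<n. c $ i * ?D (v i) (v k))"
          by (simp add: extend_pairing_sum_left extend_pairing_single_left)
        also have "\<dots> = (\<Sum>i<n. if i = k then c $ i else 0)"
          using k by (intro sum.cong) (auto simp: coord_basis)
        also have "\<dots> = c $ k" using k by simp
        finally show ?thesis ..
      qed
      then have "c = 0\<^sub>v n" using c(1) by (intro eq_vecI) auto
      with c(2) show False ..
    qed
  next
    assume nz: "det (gram_matrix B) \<noteq> 0"
    interpret F: Modules.module "\<lambda>l. Poly_Mapping.map ((*) l) :: ('m \<Rightarrow>\<^sub>0 'l) \<Rightarrow> _"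
      by (rule module_poly_mapping)
    let ?sc = "\<lambda>l. Poly_Mapping.map ((*) l) :: ('m \<Rightarrow>\<^sub>0 'l) \<Rightarrow> _"
    let ?N = "tensor_null e s"
    have N: "F.subspace ?N" unfolding tensor_null_def by (rule F.subspace_span)
    have rel: "u \<in> ?N" if "u \<in> tensor_relations e s" for u
      unfolding tensor_null_def using that by (rule F.span_base)
    have sc_single: "?sc l (?S x m) = ?S x (l * m)" for l x m
      by (rule poly_mapping_eqI) (simp add: lookup_map_times lookup_single when_def)
    have null_add: "?S (x + y) 1 - (?S x 1 + ?S y 1) \<in> ?N" for x y
      by (rule rel) (auto simp: tensor_relations_def)
    have null_scale: "?S (s r x) 1 - ?S x (e r) \<in> ?N" for r x
      by (rule rel) (auto simp: tensor_relations_def)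
    have null_0: "?S 0 1 \<in> ?N"
      using F.subspace_neg[OF N null_add[of 0 0]] by simp
    have null_sum: "?S (sum f I) 1 - (\<Sum>i\<in>I. ?S (f i) 1) \<in> ?N" if "finite I" for f :: "nat \<Rightarrow> 'm" and I
      using that
    proof (induction I rule: finite_induct)
      case empty
      show ?case using null_0 by simp
    next
      case (insert i I)
      have "?S (sum f (insert i I)) 1 - (\<Sum>i\<in>insert i I. ?S (f i) 1) =
        (?S (f i + sum f I) 1 - (?S (f i) 1 + ?S (sum f I) 1)) +
        (?S (sum f I) 1 - (\<Sum>i\<in>I. ?S (f i) 1))"
        using insert.hyps by (simp add: algebra_simps)
      then show ?case using F.subspace_add[OF N null_add insert.IH] by metis
    qed
    have null_expand: "?S x 1 - (\<Sum>i<n. ?S (v i) (j (coord x i))) \<in> ?N" for x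
    proof -
      \<comment> \<open>Clear the denominator \<open>d\<close>, expand \<open>s d x\<close>, and divide by \<open>e d\<close> in \<open>L\<close>.\<close>
      let ?t1 = "?S (s d x) 1 - ?S x (e d)"
      let ?t2 = "?S (\<Sum>i<n. s (a x i) (v i)) 1 - (\<Sum>i<n. ?S (s (a x i) (v i)) 1)"
      let ?t3 = "\<Sum>i<n. (?S (s (a x i) (v i)) 1 - ?S (v i) (e (a x i)))"
      have "?t2 + ?t3 - ?t1 \<in> ?N"
        by (intro F.subspace_diff[OF N] F.subspace_add[OF N] F.subspace_sum[OF N] null_scale null_sum)
          auto
      also have "?t2 + ?t3 - ?t1 = ?S x (e d) - (\<Sum>i<n. ?S (v i) (e (a x i)))"
        by (simp add: expansion[of x] sum_subtractf)
      finally have "?sc (inverse (e d)) (?S x (e d) - (\<Sum>i<n. ?S (v i) (e (a x i)))) \<in> ?N"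
        by (rule F.subspace_scale[OF N])
      also have "?sc (inverse (e d)) (?S x (e d) - (\<Sum>i<n. ?S (v i) (e (a x i)))) =
          ?S x 1 - (\<Sum>i<n. ?S (v i) (j (coord x i)))"
        using e_d by (simp add: F.scale_right_diff_distrib F.scale_sum_right sc_single e_numerator
            flip: mult.assoc)
      finally show ?thesis .
    qed
    show "\<forall>f. (\<forall>g. extend_pairing B f g = 0) \<longrightarrow> f \<in> ?N"
    proof (intro allI impI)
      fix f assume f: "\<forall>g. extend_pairing B f g = 0"
      let ?K = "Poly_Mapping.keys f" and ?l = "Poly_Mapping.lookup f"
      define c where "c = vec n (\<lambda>i. \<Sum>x\<in>?K. ?l x * j (coord x i))"
      have c: "c \<in> carrier_vec n" by (simp add: c_def)
      have "?G *\<^sub>v c = 0\<^sub>v n"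
      proof (rule eq_vecI)
        fix k assume "k < dim_vec (0\<^sub>v n :: 'l vec)"
        then have k: "k < n" by simp
        have "0 = (\<Sum>x\<in>?K. ?l x * B x (v k))"
          using f[rule_format, of "?S (v k) 1"] by (simp add: extend_pairing_single_right)
        also have "\<dots> = (\<Sum>x\<in>?K. ?l x * (\<Sum>i<n. j (coord x i) * B (v i) (v k)))"
          by (intro sum.cong refl arg_cong2[where f = times] linear_expansion[of "\<lambda>x. B x (v k)"])
            (use Bi in auto)
        also have "\<dots> = (\<Sum>i<n. c $ i * B (v i) (v k))"
          by (simp only: sum_distrib_left, subst sum.swap)
            (simp add: c_def sum_distrib_left sum_distrib_right ac_simps)
        finally show "(?G *\<^sub>v c) $ k = 0\<^sub>v n $ k" using Gv[OF c k] k by simp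
      qed (simp add: gram_matrix_def)
      then have "c = 0\<^sub>v n" using nz c unfolding det det_0_iff_vec_prod_zero[OF G] by blast
      then have zero: "(\<Sum>x\<in>?K. ?l x * j (coord x i)) = 0" if "i < n" for i
      proof -
        have "c $ i = 0" using \<open>c = 0\<^sub>v n\<close> that by simp
        then show ?thesis using that by (simp add: c_def)
      qed
      have "f = (\<Sum>x\<in>?K. ?sc (?l x) (?S x 1))"
        by (rule poly_mapping_eqI)
          (auto simp: sc_single lookup_sum lookup_single when_def in_keys_iff)
      also have "\<dots> = (\<Sum>x\<in>?K. ?sc (?l x) (?S x 1)) -
          (\<Sum>i<n. ?S (v i) (\<Sum>x\<in>?K. ?l x * j (coord x i)))"
        by (simp add: zero)
      also have "(\<Sum>i<n. ?S (v i) (\<Sum>x\<in>?K. ?l x * j (coord x i))) =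
          (\<Sum>x\<in>?K. ?sc (?l x) (\<Sum>i<n. ?S (v i) (j (coord x i))))"
        unfolding F.scale_sum_right sc_single
        by (subst sum.swap) (simp add: single_sum)
      also have "(\<Sum>x\<in>?K. ?sc (?l x) (?S x 1)) - \<dots> =
          (\<Sum>x\<in>?K. ?sc (?l x) (?S x 1 - (\<Sum>i<n. ?S (v i) (j (coord x i)))))"
        by (simp only: F.scale_right_diff_distrib sum_subtractf)
      also have "\<dots> \<in> ?N"
        by (intro F.subspace_sum[OF N] F.subspace_scale[OF N] null_expand)
      finally show "f \<in> ?N" .
    qed
  qed
qed

lemma nondegenerate_iff:
  assumes B: "bilinear_pairing e s B"
  shows "nondegenerate_pairing e s B \<longleftrightarrow> det (gram_matrix B) \<noteq> 0"
proof -
  let ?B = "\<lambda>x y. B y x"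
  have B': "bilinear_pairing e s ?B" using B by (simp add: bilinear_pairing_def)
  have "gram_matrix ?B = transpose_mat (gram_matrix B)"
    by (rule eq_matI) (auto simp: gram_matrix_def)
  then have "det (gram_matrix ?B) = det (gram_matrix B)"
    by (simp add: det_transpose[OF gram_matrix_carrier])
  then show ?thesis
    unfolding nondegenerate_pairing_def left_nondegenerate_iff[OF B]
      extend_pairing_swap[of B] left_nondegenerate_iff[OF B', symmetric]
    using left_nondegenerate_iff[OF B] left_nondegenerate_iff[OF B']
    by (simp add: extend_pairing_swap[of B])
qed

text \<open>
  Orthogonality of the homogeneous components as an adjointness condition.
\<close>

lemma orthogonal_iff_components_self_adjoint:
  assumes M: "\<And>c. subspace (M c)" "direct_sum_decomposition M"
    and B: "bilinear_pairing e s B"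
  shows "(\<forall>c c'. c \<noteq> c' \<longrightarrow> (\<forall>x\<in>M c. \<forall>y\<in>M c'. B x y = 0)) \<longleftrightarrow>
    (\<forall>c x y. B (component M c x) y = B x (component M c y))"
proof -
  note Bi = B[unfolded bilinear_pairing_iff[OF module_axioms e_hom]]
  have B0: "B 0 y = 0" "B x 0 = 0" for x y
    using Bi by (metis add.right_neutral add_left_cancel)+
  have sums: "B (sum f I) y = (\<Sum>i\<in>I. B (f i) y)" "B y (sum f I) = (\<Sum>i\<in>I. B y (f i))" for f I y
    using Bi by (induction I rule: infinite_finite_induct) (simp_all add: B0)
  note comp = component_in[OF M(2)] sum_component[OF M(2)] component_component[OF M]
  show ?thesis
  proof (intro iffI allI impI ballI)
    fix c x y assume orth: "\<forall>c c'. c \<noteq> c' \<longrightarrow> (\<forall>x\<in>M c. \<forall>y\<in>M c'. B x y = 0)"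
    have o: "B (component M c1 x) (component M c2 y) = 0" if "c1 \<noteq> c2" for c1 c2
      using orth that comp(1) by blast
    have "B (component M c x) y = (\<Sum>c'\<in>UNIV. B (component M c x) (component M c' y))"
      by (simp add: comp flip: sums)
    also have "\<dots> = (\<Sum>c'\<in>UNIV. if c' = c then B (component M c x) (component M c y) else 0)"
      by (intro sum.cong) (auto simp: o)
    also have "\<dots> = (\<Sum>c'\<in>UNIV. if c' = c then B (component M c' x) (component M c y) else 0)"
      by simp
    also have "\<dots> = (\<Sum>c'\<in>UNIV. B (component M c' x) (component M c y))"
      by (intro sum.cong) (auto simp: o)
    also have "\<dots> = B x (component M c y)" by (simp add: comp flip: sums)
    finally show "B (component M c x) y = B x (component M c y)" .
  next
    fix c c' x y
    assume "\<forall>c x y. B (component M c x) y = B x (component M c y)"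
      and "c \<noteq> c'" "x \<in> M c" "y \<in> M c'"
    then show "B x y = 0" using comp(3) B0 by metis
  qed
qed

text \<open>
  The set \<open>P\<close> of pairs of matrices does not involve \<open>j\<close>.
\<close>

lemma polarisable_iff_matrix:
  fixes act :: "'a::{ring,monoid_mult} \<Rightarrow> 'm \<Rightarrow> 'm" and M :: "'c::finite \<Rightarrow> 'm set"
  assumes s: "s = restrict_scale \<phi> act"
    and act: "\<And>b. module_hom s s (act b)"
    and M: "\<And>c. subspace (M c)" "direct_sum_decomposition M"
    and P: "P = range (\<lambda>b. (transpose_mat (endo_matrix (act b)), endo_matrix (act (\<iota> b)))) \<union>
      range (\<lambda>c. (transpose_mat (endo_matrix (component M c)), endo_matrix (component M c)))"
  shows "polarisable e \<phi> \<iota> act M \<longleftrightarrow>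
    (\<exists>G\<in>intertwiners n (map_prod (map_mat j) (map_mat j) ` P) {}. det G \<noteq> 0)"
proof -
  note component = component_linear[OF M]
  have iff: "polarisation e \<phi> \<iota> act M B \<longleftrightarrow>
      gram_matrix B \<in> intertwiners n (map_prod (map_mat j) (map_mat j) ` P) {} \<and>
      det (gram_matrix B) \<noteq> 0"
    if B: "bilinear_pairing e s B" for B
  proof -
    have "(\<forall>c c'. c \<noteq> c' \<longrightarrow> (\<forall>x\<in>M c. \<forall>y\<in>M c'. B x y = 0)) \<longleftrightarrow>
        (\<forall>c x y. B (component M c x) y = B x (component M c y))"
      by (rule orthogonal_iff_components_self_adjoint[OF M B])
    also have "\<dots> \<longleftrightarrow> (\<forall>c. map_mat j (transpose_mat (endo_matrix (component M c))) * gram_matrix B =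
        gram_matrix B * map_mat j (endo_matrix (component M c)))"
      by (simp only: adjoint_iff[OF B component component])
    finally have orth: "(\<forall>c c'. c \<noteq> c' \<longrightarrow> (\<forall>x\<in>M c. \<forall>y\<in>M c'. B x y = 0)) \<longleftrightarrow> \<dots>" .
    have adj: "(\<forall>b x y. B (act b x) y = B x (act (\<iota> b) y)) \<longleftrightarrow>
        (\<forall>b. map_mat j (transpose_mat (endo_matrix (act b))) * gram_matrix B =
          gram_matrix B * map_mat j (endo_matrix (act (\<iota> b))))"
      by (simp only: adjoint_iff[OF B act act])
    show ?thesis
      unfolding polarisation_def s[symmetric] nondegenerate_iff[OF B] orth adj
      using B by (auto simp: intertwiners_def P ball_Un)
  qed
  show ?thesis
  proof
    assume "polarisable e \<phi> \<iota> act M"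
    then obtain B where B: "polarisation e \<phi> \<iota> act M B" by (auto simp: polarisable_def)
    then have "bilinear_pairing e s B" by (simp add: polarisation_def s)
    with iff B show "\<exists>G\<in>intertwiners n (map_prod (map_mat j) (map_mat j) ` P) {}. det G \<noteq> 0"
      by blast
  next
    assume "\<exists>G\<in>intertwiners n (map_prod (map_mat j) (map_mat j) ` P) {}. det G \<noteq> 0"
    then obtain G where G: "G \<in> intertwiners n (map_prod (map_mat j) (map_mat j) ` P) {}"
      "det G \<noteq> 0" by blast
    then have "gram_matrix (pairing_of G) = G"
      by (intro gram_matrix_pairing_of) (simp add: intertwiners_def)
    with iff[OF bilinear_pairing_of, of G] G show "polarisable e \<phi> \<iota> act M"
      by (auto simp: polarisable_def)
  qed
qed

end

section \<open>Polarisations over extension fields\<close>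

theorem proposition3p16:
  fixes \<phi>T :: "'r::idom \<Rightarrow> 't::{comm_ring,comm_monoid_mult}"
    and \<phi>A :: "'r \<Rightarrow> 'a::{ring,monoid_mult}"
    and T :: "'c::{finite,ab_group_add} \<Rightarrow> 't set"
    and A :: "'c \<Rightarrow> 'a set"
    and \<iota>T :: "'t \<Rightarrow> 't"
    and \<iota>A :: "'a \<Rightarrow> 'a"
    and \<nu> :: "'w::group_add \<Rightarrow> 'c"
    and p :: "('w \<Rightarrow>\<^sub>0 't) \<Rightarrow> 'a"
    and act :: "'a \<Rightarrow> 'm::ab_group_add \<Rightarrow> 'm"
    and M :: "'c \<Rightarrow> 'm set"
    and j :: "'r fract \<Rightarrow> 'l::field"
  assumes "noetherian TYPE('r)"
    and "algebra_map \<phi>T" and "algebra_grading \<phi>T T"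
    and "graded_involution \<phi>T T \<iota>T"
    and "\<And>v w. \<nu> (v + w) = \<nu> v + \<nu> w"
    and "algebra_map \<phi>A" and "algebra_grading \<phi>A A"
    and "finitely_generated_module (algebra_scale \<phi>A)"
    and "group_ring_algebra_hom \<phi>T \<phi>A p" and "surj p"
    and "\<And>c. p ` group_ring_component T \<nu> c \<subseteq> A c"
    and "reduced_on (range (\<lambda>t. p (Poly_Mapping.single 0 t)))"
    and "\<And>f. \<iota>A (p f) = p (group_ring_involution \<iota>T f)"
    and "graded_module \<phi>A A act M"
    and "torsion_free (restrict_scale \<phi>A act)"
    and "unital_ring_hom j"
  shows "polarisable (\<lambda>r. Fract r 1) \<phi>A \<iota>A act M \<longleftrightarrow>
         polarisable (\<lambda>r. j (Fract r 1)) \<phi>A \<iota>A act M"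
proof -
  let ?s = "restrict_scale \<phi>A act"
  have lm: "act b (x + y) = act b x + act b y" "act (b + b') x = act b x + act b' x"
    "act (b * b') x = act b (act b' x)" "act 1 x = x" for b b' x y
    using assms(14) unfolding graded_module_def left_module_def by blast+
  have \<phi>: "\<phi>A 1 = 1" "\<phi>A (r + r') = \<phi>A r + \<phi>A r'" "\<phi>A (r * r') = \<phi>A r * \<phi>A r'"
    "\<phi>A r * b = b * \<phi>A r" for r r' b
    using assms(6) unfolding algebra_map_def unital_ring_hom_def by blast+
  have s: "Modules.module ?s"
    by unfold_locales (simp_all add: restrict_scale_def lm \<phi>(1-3))
  interpret s: Modules.module ?s by (rule s)
  have act: "module_hom ?s ?s (act b)" for b
  proof -
    have "act b (act (\<phi>A r) x) = act (\<phi>A r) (act b x)" for r x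
      using \<phi>(4)[of r b] by (simp only: lm(3)[symmetric])
    then show ?thesis by (simp add: module_hom_iff s lm(1) restrict_scale_def)
  qed
  \<comment> \<open>Products of generators of \<open>A\<close> over \<open>R\<close> and of \<open>M\<close> over \<open>A\<close> generate \<open>M\<close> over \<open>R\<close>.\<close>
  obtain FA where FA: "finite FA" "\<And>b. \<exists>r. b = (\<Sum>z\<in>FA. algebra_scale \<phi>A (r z) z)"
    using assms(8) by (auto simp: finitely_generated_module_def)
  obtain FM where FM: "finite FM" "\<And>x. \<exists>b. x = (\<Sum>y\<in>FM. act (b y) y)"
    using assms(14) by (auto simp: graded_module_def finitely_generated_module_def)
  let ?F = "(\<lambda>(z, y). act z y) ` (FA \<times> FM)"
  have F: "finite ?F" using FA(1) FM(1) by simp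
  have in_span: "x \<in> s.span ?F" for x
  proof -
    obtain b where b: "x = (\<Sum>y\<in>FM. act (b y) y)" using FM(2) by blast
    have "act (b y) y \<in> s.span ?F" if y: "y \<in> FM" for y
    proof -
      obtain r where r: "b y = (\<Sum>z\<in>FA. algebra_scale \<phi>A (r z) z)" using FA(2) by blast
      have act0: "act 0 y = 0" using lm(2)[of 0 0 y] by (metis add.right_neutral add_left_cancel)
      have act_sum: "act (\<Sum>z\<in>I. f z) y = (\<Sum>z\<in>I. act (f z) y)" for I :: "'a set" and f
        by (induction I rule: infinite_finite_induct) (simp_all add: lm act0)
      have "act (b y) y = (\<Sum>z\<in>FA. ?s (r z) (act z y))"
        unfolding r act_sum by (simp add: algebra_scale_def restrict_scale_def lm)
      also have "\<dots> \<in> s.span ?F"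
        by (intro s.span_sum s.span_scale s.span_base) (use y in auto)
      finally show ?thesis .
    qed
    then show ?thesis unfolding b by (rule s.span_sum)
  qed
  obtain n v a d where "rational_basis ?s n v a d"
    using rational_basis_exists[OF s F] in_span unfolding s.span_finite[OF F] by blast
  then interpret rational_basis ?s n v a d .
  have j: "field_hom j"
    using assms(16) by unfold_locales (auto simp: unital_ring_hom_def, metis add.right_neutral add_left_cancel)
  have id: "field_hom (\<lambda>q :: 'r fract. q)" by unfold_locales auto
  interpret Q: rational_basis_embedding ?s n v a d "\<lambda>q. q"
    using id by (intro rational_basis_embedding.intro rational_basis_axioms)
  interpret L: rational_basis_embedding ?s n v a d j
    using j by (intro rational_basis_embedding.intro rational_basis_axioms)
  have M: "\<And>c. s.subspace (M c)" "direct_sum_decomposition M"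
    using assms(14) by (auto simp: graded_module_def)
  define P where "P = range (\<lambda>b. (transpose_mat (endo_matrix (act b)), endo_matrix (act (\<iota>A b)))) \<union>
      range (\<lambda>c. (transpose_mat (endo_matrix (component M c)), endo_matrix (component M c)))"
  have P: "P \<subseteq> carrier_mat n n \<times> carrier_mat n n" by (auto simp: P_def)
  have "polarisable (\<lambda>r. Fract r 1) \<phi>A \<iota>A act M \<longleftrightarrow>
      (\<exists>G\<in>intertwiners n (map_prod (map_mat (\<lambda>q. q)) (map_mat (\<lambda>q. q)) ` P) {}. det G \<noteq> 0)"
    by (rule Q.polarisable_iff_matrix[OF refl act M P_def])
  also have "\<dots> \<longleftrightarrow> (\<exists>H\<in>intertwiners n P {}. det H \<noteq> 0)"
    by (rule noether_deuring[OF id P])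
  also have "\<dots> \<longleftrightarrow> (\<exists>G\<in>intertwiners n (map_prod (map_mat j) (map_mat j) ` P) {}. det G \<noteq> 0)"
    by (rule noether_deuring[OF j P, symmetric])
  also have "\<dots> \<longleftrightarrow> polarisable (\<lambda>r. j (Fract r 1)) \<phi>A \<iota>A act M"
    by (rule L.polarisable_iff_matrix[OF refl act M P_def, symmetric])
  finally show ?thesis .
qed

end
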